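(* Let $S(\mathbf{G},\mathbf{\Sigma})$ be a constrained switching system with $\mathbf{\Sigma}\subset\mathbb{R}^{n\times n}$, and let $d\ge1$ be an integer. Let $S^{[d]}(\mathbf{G},\mathbf{\Sigma})$ be the constrained switching system on the same automaton $\mathbf{G}$ with matrix set $\mathbf{\Sigma}^{[d]}=\{A^{[d]}:A\in\mathbf{\Sigma}\}$ (same labels). Then $$\hat\rho(S)\le\gamma_*(S^{[d]})^{1/d}\le C(n+d-1,d)^{1/(2d)}\,\hat\rho(S),$$ where $C(k,\ell)=\binom{k}{\ell}$.
   Context: An automaton $\mathbf{G}(V,E)$ is a strongly connected directed graph with finite node set $V$ and finite edge set $E$ of labelled edges $(v,w,\sigma)$, $\sigma$ indexing a matrix $A_\sigma$. A label sequence is accepted by $\mathbf{G}$ if it is the succession of labels along some path of $\mathbf{G}$ (no prescribed initial/final node). The constrained switching system $S(\mathbf{G},\mathbf{\Sigma})$ is $x_{t+1}=A_{\sigma(t)}x_t$ with accepted switching sequences; its CJSR is $\hat\rho(S)=\lim_{t\to\infty}\max\{\|A_{\sigma(t-1)}\cdots A_{\sigma(0)}\|^{1/t} : \sigma(0),\dots,\sigma(t-1)\text{ accepted}\}$. The $[d]$-lift: for $x\in\mathbb{R}^n$, $x^{[d]}\in\mathbb{R}^{C(n+d-1,d)}$ is the vector with entries $\sqrt{\binom{d}{\alpha}}\,x^\alpha$ indexed by multi-indices $\alpha\in\mathbb{N}^n$ with $|\alpha|=d$ (multinomial coefficients), so that $|x^{[d]}|=|x|^d$ for Euclidean norms. For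 $A\in\mathbb{R}^{n\times n}$, $A^{[d]}$ is the unique $C(n+d-1,d)\times C(n+d-1,d)$ matrix with $A^{[d]}x^{[d]}=(Ax)^{[d]}$ for all $x$. For a constrained switching system $S'$ on automaton $(V',E')$ with matrices in $\mathbb{R}^{m\times m}$, $\gamma_*(S')$ is the infimum of $\gamma$ such that there exist symmetric $Q_v\succ0$ ($v\in V'$) with $\gamma^2Q_v-A_\sigma^\top Q_wA_\sigma\succeq0$ for all $(v,w,\sigma)\in E'$. *)

theory Defs
  imports "HOL-Analysis.Analysis"
begin

section \<open>Automata and constrained switching systems\<close>

text \<open>An automaton is given by a node set V and a set E of labelled edges (v, w, sigma).
  It must be finite, nonempty, with edges between nodes of V, and strongly connected.\<close>

definition edge_rel :: "('v \<times> 'v \<times> 'l) set \<Rightarrow> ('v \<times> 'v) set" where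
  "edge_rel E = {(v, w). \<exists>s. (v, w, s) \<in> E}"

definition automaton :: "'v set \<Rightarrow> ('v \<times> 'v \<times> 'l) set \<Rightarrow> bool" where
  "automaton V E \<longleftrightarrow> finite V \<and> finite E \<and> V \<noteq> {} \<and> E \<noteq> {} \<and>
     E \<subseteq> V \<times> V \<times> UNIV \<and> (\<forall>v\<in>V. \<forall>w\<in>V. (v, w) \<in> (edge_rel E)\<^sup>*)"

text \<open>A label sequence sigma(0), ..., sigma(t-1) is accepted if it is the succession of
  labels along some path of the automaton (no prescribed initial/final node).\<close>

definition accepted :: "('v \<times> 'v \<times> 'l) set \<Rightarrow> nat \<Rightarrow> (nat \<Rightarrow> 'l) \<Rightarrow> bool" where
  "accepted E t \<sigma> \<longleftrightarrow> (\<exists>p :: nat \<Rightarrow> 'v. \<forall>k<t. (p k, p (Suc k), \<sigma> k) \<in> E)"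

text \<open>The product A_{sigma(t-1)} ... A_{sigma(0)}.\<close>

fun mprod :: "('l \<Rightarrow> real^'n^'n) \<Rightarrow> (nat \<Rightarrow> 'l) \<Rightarrow> nat \<Rightarrow> real^'n^'n" where
  "mprod A \<sigma> 0 = mat 1"
| "mprod A \<sigma> (Suc t) = A (\<sigma> t) ** mprod A \<sigma> t"

text \<open>Constrained joint spectral radius, with the operator norm induced by the Euclidean norm.\<close>

definition cjsr :: "('v \<times> 'v \<times> 'l) set \<Rightarrow> ('l \<Rightarrow> real^'n^'n) \<Rightarrow> real" where
  "cjsr E A = lim (\<lambda>t. Max {onorm (\<lambda>x. mprod A \<sigma> t *v x) powr (1 / real t) | \<sigma>. accepted E t \<sigma>})"

section \<open>The [d]-lift\<close>

text \<open>Multi-indices alpha with |alpha| = d.\<close>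

definition multi_idx :: "nat \<Rightarrow> ('n::finite \<Rightarrow> nat) set" where
  "multi_idx d = {\<alpha>. sum \<alpha> UNIV = d}"

definition multinomial_coeff :: "nat \<Rightarrow> ('n::finite \<Rightarrow> nat) \<Rightarrow> real" where
  "multinomial_coeff d \<alpha> = fact d / (\<Prod>i\<in>UNIV. fact (\<alpha> i))"

definition lift_vec :: "nat \<Rightarrow> real^'n::finite \<Rightarrow> ('n \<Rightarrow> nat) \<Rightarrow> real" where
  "lift_vec d x \<alpha> = sqrt (multinomial_coeff d \<alpha>) * (\<Prod>i\<in>UNIV. (x $ i) ^ (\<alpha> i))"

text \<open>Matrices indexed by a finite index set are represented as functions, with entries
  outside the index set equal to zero. A^[d] is the unique matrix with
  A^[d] x^[d] = (A x)^[d] for all x.\<close>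

definition lift_mat :: "nat \<Rightarrow> real^'n^'n \<Rightarrow> ('n::finite \<Rightarrow> nat) \<Rightarrow> ('n \<Rightarrow> nat) \<Rightarrow> real" where
  "lift_mat d A = (THE B. (\<forall>\<alpha> \<beta>. (\<alpha> \<notin> multi_idx d \<or> \<beta> \<notin> multi_idx d) \<longrightarrow> B \<alpha> \<beta> = 0) \<and>
      (\<forall>x. \<forall>\<alpha>\<in>multi_idx d. (\<Sum>\<beta>\<in>multi_idx d. B \<alpha> \<beta> * lift_vec d x \<beta>) = lift_vec d (A *v x) \<alpha>))"

section \<open>gamma_* via quadratic Lyapunov functions, for matrices over a finite index set I\<close>

definition qform :: "'i set \<Rightarrow> ('i \<Rightarrow> 'i \<Rightarrow> real) \<Rightarrow> ('i \<Rightarrow> real) \<Rightarrow> real" where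
  "qform I Q x = (\<Sum>i\<in>I. \<Sum>j\<in>I. x i * Q i j * x j)"

definition mapply :: "'i set \<Rightarrow> ('i \<Rightarrow> 'i \<Rightarrow> real) \<Rightarrow> ('i \<Rightarrow> real) \<Rightarrow> ('i \<Rightarrow> real)" where
  "mapply I M x = (\<lambda>i. \<Sum>j\<in>I. M i j * x j)"

definition sym_on :: "'i set \<Rightarrow> ('i \<Rightarrow> 'i \<Rightarrow> real) \<Rightarrow> bool" where
  "sym_on I Q \<longleftrightarrow> (\<forall>i\<in>I. \<forall>j\<in>I. Q i j = Q j i)"

text \<open>Positive definite: x^T Q x > 0 for all nonzero x in R^I.\<close>
definition posdef_on :: "'i set \<Rightarrow> ('i \<Rightarrow> 'i \<Rightarrow> real) \<Rightarrow> bool" where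
  "posdef_on I Q \<longleftrightarrow> (\<forall>x. (\<exists>i\<in>I. x i \<noteq> 0) \<longrightarrow> qform I Q x > 0)"

text \<open>gamma^2 Q_v - A^T Q_w A is positive semidefinite, i.e.
  x^T (gamma^2 Q_v - A^T Q_w A) x >= 0 for all x in R^I.\<close>
definition lyap_feasible ::
  "'i set \<Rightarrow> 'v set \<Rightarrow> ('v \<times> 'v \<times> 'l) set \<Rightarrow> ('l \<Rightarrow> 'i \<Rightarrow> 'i \<Rightarrow> real) \<Rightarrow> real \<Rightarrow> bool" where
  "lyap_feasible I V E M \<gamma> \<longleftrightarrow> (\<exists>Q :: 'v \<Rightarrow> 'i \<Rightarrow> 'i \<Rightarrow> real.
     (\<forall>v\<in>V. sym_on I (Q v) \<and> posdef_on I (Q v)) \<and>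
     (\<forall>(v, w, s)\<in>E. \<forall>x. \<gamma>\<^sup>2 * qform I (Q v) x - qform I (Q w) (mapply I (M s) x) \<ge> 0))"

definition gamma_star ::
  "'i set \<Rightarrow> 'v set \<Rightarrow> ('v \<times> 'v \<times> 'l) set \<Rightarrow> ('l \<Rightarrow> 'i \<Rightarrow> 'i \<Rightarrow> real) \<Rightarrow> real" where
  "gamma_star I V E M = Inf {\<gamma>. \<gamma> \<ge> 0 \<and> lyap_feasible I V E M \<gamma>}"

end

theory Submission
  imports Defs "HOL-Library.Multiset" "Jordan_Normal_Form.Determinant"
begin

text \<open>
  Lower bound: along a path with label word \<open>\<sigma>\<close>, a feasible family \<open>Q\<close> satisfies
  \<open>Q\<^sub>w((A\<^sub>\<sigma> x)\<^bsup>[d]\<^esup>) \<le> \<gamma>\<^bsup>2t\<^esup> Q\<^sub>v(x\<^bsup>[d]\<^esup>)\<close>, and \<open>Q\<^sub>v(x\<^bsup>[d]\<^esup>)\<close> is comparable to \<open>|x|\<^bsup>2d\<^esup>\<close> by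
  compactness of the unit sphere.

  Upper bound: fix \<open>r\<close> above the constrained joint spectral radius. At a node \<open>v\<close> consider all
  functionals \<open>\<langle>y\<^bsup>[d]\<^esup>, \<cdot>\<rangle>\<close>, where \<open>y = r\<^bsup>-t\<^esup> A\<^sub>\<sigma>\<^sup>T z\<close> for a path from \<open>v\<close> with word \<open>\<sigma>\<close> of length
  \<open>t\<close> and \<open>z\<close> in a fixed ball. They are bounded, they span, and since
  \<open>\<langle>y\<^bsup>[d]\<^esup>, A\<^bsup>[d]\<^esup> x\<rangle> = \<langle>(A\<^sup>T y)\<^bsup>[d]\<^esup>, x\<rangle>\<close> an edge from \<open>v\<close> to \<open>w\<close> maps the family at \<open>w\<close> into \<open>r\<^sup>d\<close>
  times the family at \<open>v\<close>. John's theorem gives a quadratic form that agrees with the supremum of the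
  squared functionals up to the factor \<open>N = C(n+d-1, d)\<close>, the dimension of the lifted space. As
  \<open>\<gamma>\<^sub>*\<close> is an infimum, the factor \<open>N + \<epsilon>\<close> suffices; it follows from a form whose determinant is
  nearly maximal, without any compactness argument in the lifted space.
\<close>

no_notation Matrix.vec_index (infixl "$" 100)

section \<open>The constrained joint spectral radius as a limit\<close>

lemma power_powr_inverse:
  fixes r :: real
  assumes "0 \<le> r" "n \<ge> 1"
  shows "(r ^ n) powr (1 / real n) = r"
proof (cases "r = 0")
  case False
  then have "(r ^ n) powr (1 / real n) = (r powr real n) powr (1 / real n)"
    using assms by (simp add: powr_realpow)
  also have "\<dots> = r" using assms False by (simp add: powr_powr)
  finally show ?thesis .
qed (use assms in auto)

lemma powr_inverse_power:
  fixes r :: real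
  assumes "0 \<le> r" "n \<ge> 1"
  shows "(r powr (1 / real n)) ^ n = r"
proof (cases "r = 0")
  case False
  then have "(r powr (1 / real n)) ^ n = (r powr (1 / real n)) powr real n"
    by (intro powr_realpow[symmetric]) simp
  also have "\<dots> = r" using assms False by (simp add: powr_powr)
  finally show ?thesis .
qed (use assms in auto)

lemma powr_inverse_nat_le:
  fixes a r K :: real
  assumes "a \<le> K * r ^ n" "0 \<le> a" "0 \<le> r" "0 < K" "n \<ge> 1"
  shows "a powr (1 / real n) \<le> K powr (1 / real n) * r"
proof -
  have "a powr (1 / real n) \<le> (K * r ^ n) powr (1 / real n)"
    using assms by (intro powr_mono2) auto
  also have "\<dots> = K powr (1 / real n) * (r ^ n) powr (1 / real n)"
    using assms by (intro powr_mult)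
  also have "(r ^ n) powr (1 / real n) = r" using assms by (intro power_powr_inverse)
  finally show ?thesis .
qed

lemma const_root_mult_tendsto:
  fixes K r :: real
  assumes "K > 0"
  shows "(\<lambda>n. K powr (1 / real n) * r) \<longlonglongrightarrow> r"
proof -
  have "(\<lambda>n. K powr (1 / real n) * r) \<longlonglongrightarrow> K powr 0 * r"
    using assms by (intro tendsto_intros lim_1_over_n) auto
  then show ?thesis using assms by simp
qed

text \<open>Write the index as \<open>q * m + k\<close> with \<open>k < m\<close>: every block of
  length \<open>m\<close> costs at most \<open>r ^ m\<close>, and the finitely many remainders go
  into the constant.\<close>

lemma submultiplicative_growth:
  fixes a :: "nat \<Rightarrow> real"
  assumes nonneg: "\<And>n. a n \<ge> 0" and sub: "\<And>m n. a (m + n) \<le> a m * a n"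
    and m: "m \<ge> 1" and r: "r > 0" and am: "a m \<le> r ^ m"
  shows "\<exists>K>0. \<forall>n. a n \<le> K * r ^ n"
proof -
  \<comment> \<open>The summand 1 keeps \<open>K\<close> positive even if every \<open>a k\<close>
    vanishes.\<close>
  define K where "K = 1 + (\<Sum>k<m. a k / r ^ k)"
  have K: "K > 0" unfolding K_def using r nonneg by (intro add_pos_nonneg sum_nonneg) auto
  have ak: "a k \<le> K * r ^ k" if "k < m" for k
  proof -
    have "a k / r ^ k \<le> (\<Sum>k<m. a k / r ^ k)"
      using that r nonneg by (intro member_le_sum) auto
    then have "a k / r ^ k \<le> K" by (simp add: K_def)
    then show ?thesis using r by (simp add: field_simps)
  qed
  have *: "a (q * m + k) \<le> K * r ^ (q * m + k)" if "k < m" for q k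
  proof (induction q)
    case 0
    then show ?case using ak[OF that] by simp
  next
    case (Suc q)
    have "a (Suc q * m + k) \<le> a m * a (q * m + k)"
      using sub[of m "q * m + k"] by (simp add: add.assoc)
    also have "\<dots> \<le> r ^ m * (K * r ^ (q * m + k))"
      using Suc am r nonneg by (intro mult_mono) auto
    finally show ?case by (simp add: power_add mult_ac)
  qed
  have "a n \<le> K * r ^ n" for n
    using *[of "n mod m" "n div m"] m by simp
  then show ?thesis using K by blast
qed

text \<open>Fekete's lemma in multiplicative form: the limit is the infimum of the roots. Avoiding
  logarithms admits sequences with zeros.\<close>

lemma submultiplicative_root_convergent:
  fixes a :: "nat \<Rightarrow> real"
  assumes nonneg: "\<And>n. a n \<ge> 0" and sub: "\<And>m n. a (m + n) \<le> a m * a n"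
  shows "convergent (\<lambda>n. a n powr (1 / real n))"
proof -
  let ?b = "\<lambda>n. a n powr (1 / real n)"
  \<comment> \<open>Index 0 is left out: there the exponent \<open>1 / real 0\<close> is 0 and the
    value says nothing about growth.\<close>
  define l where "l = Inf (?b ` {1..})"
  have bdd: "bdd_below (?b ` {1..})" by (rule bdd_belowI[of _ 0]) auto
  have l0: "l \<ge> 0" unfolding l_def by (rule cInf_greatest) auto
  have lb: "l \<le> ?b n" if "n \<ge> 1" for n
    unfolding l_def by (rule cInf_lower[OF _ bdd]) (use that in auto)
  have "?b \<longlonglongrightarrow> l"
  proof (rule tendstoI)
    fix e :: real assume e: "e > 0"
    define r where "r = l + e / 2"
    have r: "r > 0" using l0 e by (simp add: r_def)
    have "Inf (?b ` {1..}) < r" using e by (simp add: r_def l_def)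
    then obtain m where m: "m \<ge> 1" "?b m < r"
      by (subst (asm) cInf_less_iff[OF _ bdd]) auto
    have "a m \<le> r ^ m"
      using power_mono[of "?b m" r m] m powr_inverse_power[OF nonneg[of m] m(1)] by simp
    then obtain K where K: "K > 0" "\<And>n. a n \<le> K * r ^ n"
      using submultiplicative_growth[OF nonneg sub m(1) r] by blast
    have "eventually (\<lambda>n. K powr (1 / real n) * r < l + e) sequentially"
      using order_tendstoD(2)[OF const_root_mult_tendsto[OF K(1)], of r "l + e"] e by (simp add: r_def)
    then show "eventually (\<lambda>n. dist (?b n) l < e) sequentially"
      using eventually_ge_at_top[of 1]
    proof eventually_elim
      case (elim n)
      have "?b n \<le> K powr (1 / real n) * r"
        using powr_inverse_nat_le[OF K(2) nonneg _ K(1)] r elim by simp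
      then show ?case using elim lb[of n] by (simp add: dist_real_def)
    qed
  qed
  then show ?thesis by (rule convergentI)
qed

section \<open>Matrix products along accepted words\<close>

lemma mprod_add: "mprod A \<sigma> (s + t) = mprod A (\<lambda>k. \<sigma> (s + k)) t ** mprod A \<sigma> s"
  by (induction t) (simp_all add: matrix_mul_assoc)

lemma mprod_Suc_shift: "mprod A \<sigma> (Suc t) = mprod A (\<lambda>k. \<sigma> (Suc k)) t ** A (\<sigma> 0)"
  using mprod_add[of A \<sigma> 1 t] by simp

lemma accepted_add:
  assumes "accepted E (s + t) \<sigma>"
  shows "accepted E s \<sigma>" "accepted E t (\<lambda>k. \<sigma> (s + k))"
proof -
  obtain p where p: "\<forall>k<s + t. (p k, p (Suc k), \<sigma> k) \<in> E" using assms by (auto simp: accepted_def)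
  then show "accepted E s \<sigma>" unfolding accepted_def by (intro exI[of _ p]) auto
  show "accepted E t (\<lambda>k. \<sigma> (s + k))"
    unfolding accepted_def by (rule exI[of _ "\<lambda>k. p (s + k)"]) (use p in auto)
qed

text \<open>Some edge has a source \<open>a\<close>. A node other than \<open>a\<close> reaches
  \<open>a\<close> by strong connectivity, and the first edge of that path leaves the node.\<close>

lemma automaton_successor:
  assumes "automaton V E" "v \<in> V"
  shows "\<exists>w s. (v, w, s) \<in> E \<and> w \<in> V"
proof -
  obtain a b l where e: "(a, b, l) \<in> E" "a \<in> V" "b \<in> V"
    using assms by (auto simp: automaton_def)
  show ?thesis
  proof (cases "v = a")
    case False
    have "(v, a) \<in> (edge_rel E)\<^sup>*" using assms e by (auto simp: automaton_def)
    then obtain w where "(v, w) \<in> edge_rel E" using False by (auto elim: converse_rtranclE)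
    then show ?thesis using assms by (auto simp: edge_rel_def automaton_def)
  qed (use e in blast)
qed

lemma accepted_exists:
  assumes "automaton V E"
  shows "\<exists>\<sigma>. accepted E t \<sigma>"
proof -
  obtain f g where fg: "\<And>v. v \<in> V \<Longrightarrow> (v, f v, g v) \<in> E \<and> f v \<in> V"
    using automaton_successor[OF assms] by metis
  obtain v where v: "v \<in> V" using assms by (auto simp: automaton_def)
  have "(f ^^ k) v \<in> V" for k by (induction k) (use v fg in auto)
  then show ?thesis unfolding accepted_def
    using fg by (intro exI[of _ "\<lambda>k. g ((f ^^ k) v)"] exI[of _ "\<lambda>k. (f ^^ k) v"]) auto
qed

text \<open>A word is a function on all of \<open>nat\<close> that is arbitrary from
  \<open>t\<close> on, so there may be infinitely many accepted words; only their products of length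
  \<open>t\<close> are finite in number.\<close>

lemma finite_accepted_products:
  assumes "finite E"
  shows "finite {mprod A \<sigma> t | \<sigma>. accepted E t \<sigma>}"
proof (induction t)
  case 0
  show ?case by (rule finite_subset[of _ "{Finite_Cartesian_Product.mat 1}"]) auto
next
  case (Suc t)
  let ?S = "(snd \<circ> snd) ` E"
  have "{mprod A \<sigma> (Suc t) | \<sigma>. accepted E (Suc t) \<sigma>}
      \<subseteq> (\<lambda>(s, M). A s ** M) ` (?S \<times> {mprod A \<sigma> t | \<sigma>. accepted E t \<sigma>})"
  proof
    fix M assume "M \<in> {mprod A \<sigma> (Suc t) | \<sigma>. accepted E (Suc t) \<sigma>}"
    then obtain \<sigma> where M: "M = A (\<sigma> t) ** mprod A \<sigma> t" and acc: "accepted E (Suc t) \<sigma>" by auto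
    have "\<sigma> t \<in> ?S" using acc by (force simp: accepted_def)
    moreover have "accepted E t \<sigma>" using accepted_add(1)[of E t 1 \<sigma>] acc by simp
    ultimately show "M \<in> (\<lambda>(s, M). A s ** M) ` (?S \<times> {mprod A \<sigma> t | \<sigma>. accepted E t \<sigma>})"
      unfolding M by (intro image_eqI[of _ _ "(\<sigma> t, mprod A \<sigma> t)"]) auto
  qed
  then show ?case by (rule finite_subset) (use Suc assms in auto)
qed

text \<open>Taking the maximum before the root gives a submultiplicative sequence, to which Fekete's
  lemma applies.\<close>

definition max_growth :: "('v \<times> 'v \<times> 'l) set \<Rightarrow> ('l \<Rightarrow> real^'n^'n) \<Rightarrow> nat \<Rightarrow> real" where
  "max_growth E A t = Max {onorm ((*v) (mprod A \<sigma> t)) | \<sigma>. accepted E t \<sigma>}"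

lemma finite_accepted_onorms:
  assumes "finite E"
  shows "finite {onorm ((*v) (mprod A \<sigma> t)) | \<sigma>. accepted E t \<sigma>}"
proof -
  have "{onorm ((*v) (mprod A \<sigma> t)) | \<sigma>. accepted E t \<sigma>}
      = (\<lambda>M. onorm ((*v) M)) ` {mprod A \<sigma> t | \<sigma>. accepted E t \<sigma>}" by auto
  then show ?thesis using finite_imageI[OF finite_accepted_products[OF assms]] by simp
qed

lemma onorm_le_max_growth:
  assumes "finite E" "accepted E t \<sigma>"
  shows "onorm ((*v) (mprod A \<sigma> t)) \<le> max_growth E A t"
  unfolding max_growth_def
  by (rule Max_ge[OF finite_accepted_onorms[OF assms(1)]]) (use assms(2) in auto)

lemma max_growth_attained:
  assumes "automaton V E"
  obtains \<sigma> where "accepted E t \<sigma>" "max_growth E A t = onorm ((*v) (mprod A \<sigma> t))"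
proof -
  have "finite E" using assms by (simp add: automaton_def)
  then have "max_growth E A t \<in> {onorm ((*v) (mprod A \<sigma> t)) | \<sigma>. accepted E t \<sigma>}"
    unfolding max_growth_def using accepted_exists[OF assms, of t]
    by (intro Max_in finite_accepted_onorms) auto
  then show ?thesis using that by auto
qed

lemma max_growth_nonneg:
  assumes "automaton V E"
  shows "max_growth E A t \<ge> 0"
proof -
  obtain \<sigma> where "max_growth E A t = onorm ((*v) (mprod A \<sigma> t))"
    by (rule max_growth_attained[OF assms])
  then show ?thesis by (simp add: onorm_pos_le)
qed

text \<open>A maximizing word of length \<open>s + t\<close> splits into two accepted words, and the
  operator norm is submultiplicative.\<close>

lemma max_growth_submultiplicative:
  assumes "automaton V E"
  shows "max_growth E A (s + t) \<le> max_growth E A s * max_growth E A t"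
proof -
  have E: "finite E" using assms by (simp add: automaton_def)
  obtain \<sigma> where \<sigma>: "accepted E (s + t) \<sigma>" "max_growth E A (s + t) = onorm ((*v) (mprod A \<sigma> (s + t)))"
    by (rule max_growth_attained[OF assms])
  let ?B = "mprod A (\<lambda>k. \<sigma> (s + k)) t" and ?C = "mprod A \<sigma> s"
  have "max_growth E A (s + t) = onorm ((*v) ?B \<circ> (*v) ?C)"
    by (simp add: \<sigma>(2) mprod_add o_def matrix_vector_mul_assoc)
  also have "\<dots> \<le> onorm ((*v) ?B) * onorm ((*v) ?C)"
    by (intro onorm_compose) auto
  also have "\<dots> \<le> max_growth E A t * max_growth E A s"
    using accepted_add[OF \<sigma>(1)]
    by (intro mult_mono onorm_le_max_growth E max_growth_nonneg[OF assms] onorm_pos_le) auto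
  finally show ?thesis by (simp add: mult.commute)
qed

text \<open>The root is monotone, so it commutes with the maximum; convergence then makes the
  \<open>lim\<close> in the definition a genuine limit.\<close>

lemma cjsr_tendsto:
  assumes "automaton V E"
  shows "(\<lambda>t. max_growth E A t powr (1 / real t)) \<longlonglongrightarrow> cjsr E A"
proof -
  have E: "finite E" using assms by (simp add: automaton_def)
  have "Max {onorm ((*v) (mprod A \<sigma> t)) powr (1 / real t) | \<sigma>. accepted E t \<sigma>}
      = max_growth E A t powr (1 / real t)" for t
  proof (rule Max_eqI)
    have "{onorm ((*v) (mprod A \<sigma> t)) powr (1 / real t) | \<sigma>. accepted E t \<sigma>}
      = (\<lambda>x. x powr (1 / real t)) ` {onorm ((*v) (mprod A \<sigma> t)) | \<sigma>. accepted E t \<sigma>}" by auto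
    then show "finite {onorm ((*v) (mprod A \<sigma> t)) powr (1 / real t) | \<sigma>. accepted E t \<sigma>}"
      using finite_imageI[OF finite_accepted_onorms[OF E]] by simp
  next
    fix y assume "y \<in> {onorm ((*v) (mprod A \<sigma> t)) powr (1 / real t) | \<sigma>. accepted E t \<sigma>}"
    then obtain \<sigma> where "accepted E t \<sigma>" "y = onorm ((*v) (mprod A \<sigma> t)) powr (1 / real t)"
      by blast
    then show "y \<le> max_growth E A t powr (1 / real t)"
      using onorm_le_max_growth[OF E, of t \<sigma> A]
      by (simp add: powr_mono2 onorm_pos_le)
  next
    obtain \<sigma> where "accepted E t \<sigma>" "max_growth E A t = onorm ((*v) (mprod A \<sigma> t))"
      by (rule max_growth_attained[OF assms])
    then show "max_growth E A t powr (1 / real t)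
        \<in> {onorm ((*v) (mprod A \<sigma> t)) powr (1 / real t) | \<sigma>. accepted E t \<sigma>}"
      by auto
  qed
  then have "cjsr E A = lim (\<lambda>t. max_growth E A t powr (1 / real t))"
    by (simp add: cjsr_def)
  then show ?thesis
    using submultiplicative_root_convergent[of "max_growth E A",
        OF max_growth_nonneg[OF assms] max_growth_submultiplicative[OF assms]]
    by (simp add: convergent_LIMSEQ_iff)
qed

lemma cjsr_nonneg: "automaton V E \<Longrightarrow> cjsr E A \<ge> 0"
  by (rule LIMSEQ_le_const[OF cjsr_tendsto]) auto

lemma cjsr_le:
  assumes "automaton V E" "r \<ge> 0" "K > 0"
    and "\<And>t. t \<ge> 1 \<Longrightarrow> max_growth E A t \<le> K * r ^ t"
  shows "cjsr E A \<le> r"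
proof (rule LIMSEQ_le[OF cjsr_tendsto[OF assms(1)] const_root_mult_tendsto[OF assms(3)]])
  show "\<exists>N. \<forall>t\<ge>N. max_growth E A t powr (1 / real t) \<le> K powr (1 / real t) * r"
    by (intro exI[of _ 1] allI impI powr_inverse_nat_le assms max_growth_nonneg[OF assms(1)])
qed

text \<open>One length \<open>m\<close> whose root lies below \<open>r\<close> already controls all
  lengths, by submultiplicativity.\<close>

lemma max_growth_bound:
  assumes "automaton V E" "cjsr E A < r"
  shows "\<exists>K>0. \<forall>t. max_growth E A t \<le> K * r ^ t"
proof -
  let ?a = "max_growth E A"
  have r: "r > 0" using cjsr_nonneg[OF assms(1), of A] assms(2) by linarith
  have "eventually (\<lambda>t. ?a t powr (1 / real t) < r) sequentially"
    by (rule order_tendstoD(2)[OF cjsr_tendsto[OF assms(1)] assms(2)])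
  then have "eventually (\<lambda>t. ?a t powr (1 / real t) < r \<and> t \<ge> 1) sequentially"
    using eventually_ge_at_top[of 1] by (rule eventually_conj)
  then obtain m where m: "m \<ge> 1" "?a m powr (1 / real m) < r"
    using eventually_happens'[OF sequentially_bot] by blast
  have "?a m \<le> r ^ m"
    using power_mono[of "?a m powr (1 / real m)" r m] m
      powr_inverse_power[OF max_growth_nonneg[OF assms(1)] m(1), of A] by simp
  then show ?thesis
    by (rule submultiplicative_growth[of ?a, OF max_growth_nonneg[OF assms(1)]
          max_growth_submultiplicative[OF assms(1)] m(1) r])
qed

section \<open>The lift\<close>

definition dot_on :: "'i set \<Rightarrow> ('i \<Rightarrow> real) \<Rightarrow> ('i \<Rightarrow> real) \<Rightarrow> real" where
  "dot_on I x y = (\<Sum>i\<in>I. x i * y i)"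

text \<open>Restricting the support to \<open>S\<close> allows induction on the set of coordinates;
  prescribing 0 outside \<open>S\<close> keeps each multi-index a unique function.\<close>

definition multi_idx_on :: "'n set \<Rightarrow> nat \<Rightarrow> ('n \<Rightarrow> nat) set" where
  "multi_idx_on S d = {\<alpha>. (\<forall>i. i \<notin> S \<longrightarrow> \<alpha> i = 0) \<and> sum \<alpha> S = d}"

text \<open>The multi-indices on \<open>insert a S\<close> are sorted by their exponent
  \<open>k\<close> at \<open>a\<close>; resetting that entry to 0 leaves a multi-index on
  \<open>S\<close> of degree \<open>d - k\<close>.\<close>

lemma sum_multi_idx_on_insert:
  fixes t :: "'n \<Rightarrow> nat \<Rightarrow> real"
  assumes S: "finite S" "a \<notin> S" and fin: "\<And>d. finite (multi_idx_on S d)"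
  shows "(\<Sum>\<alpha>\<in>multi_idx_on (insert a S) d. \<Prod>i\<in>insert a S. t i (\<alpha> i))
       = (\<Sum>k\<le>d. t a k * (\<Sum>\<beta>\<in>multi_idx_on S (d - k). \<Prod>i\<in>S. t i (\<beta> i)))"
proof -
  have "(\<Sum>k\<le>d. t a k * (\<Sum>\<beta>\<in>multi_idx_on S (d - k). \<Prod>i\<in>S. t i (\<beta> i)))
      = (\<Sum>(k, \<beta>)\<in>(SIGMA k:{..d}. multi_idx_on S (d - k)). t a k * (\<Prod>i\<in>S. t i (\<beta> i)))"
    by (simp add: sum_distrib_left sum.Sigma fin)
  also have "\<dots> = (\<Sum>\<alpha>\<in>multi_idx_on (insert a S) d. \<Prod>i\<in>insert a S. t i (\<alpha> i))"
  proof (rule sum.reindex_bij_witness[where i = "\<lambda>\<alpha>. (\<alpha> a, \<alpha>(a := 0))" and j = "\<lambda>(k, \<beta>). \<beta>(a := k)"])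
    fix p assume p: "p \<in> (SIGMA k:{..d}. multi_idx_on S (d - k))"
    obtain k \<beta> where k: "p = (k, \<beta>)" by force
    have upd: "sum (\<beta>(a := k)) S = sum \<beta> S"
      by (rule sum.cong) (use S in auto)
    have pr: "(\<Prod>i\<in>S. t i ((\<beta>(a := k)) i)) = (\<Prod>i\<in>S. t i (\<beta> i))"
      by (rule prod.cong) (use S in auto)
    show "((case p of (k, \<beta>) \<Rightarrow> \<beta>(a := k)) a, (case p of (k, \<beta>) \<Rightarrow> \<beta>(a := k))(a := 0)) = p"
      using p S by (auto simp: k multi_idx_on_def fun_eq_iff)
    show "(case p of (k, \<beta>) \<Rightarrow> \<beta>(a := k)) \<in> multi_idx_on (insert a S) d"
      using p S upd by (auto simp: k multi_idx_on_def)
    show "(\<Prod>i\<in>insert a S. t i ((case p of (k, \<beta>) \<Rightarrow> \<beta>(a := k)) i))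
        = (case p of (k, \<beta>) \<Rightarrow> t a k * (\<Prod>i\<in>S. t i (\<beta> i)))"
      using S pr by (simp add: k)
  next
    fix \<alpha> assume \<alpha>: "\<alpha> \<in> multi_idx_on (insert a S) d"
    have upd: "sum (\<alpha>(a := 0)) S = sum \<alpha> S"
      by (rule sum.cong) (use S in auto)
    show "(case (\<alpha> a, \<alpha>(a := 0)) of (k, \<beta>) \<Rightarrow> \<beta>(a := k)) = \<alpha>" by simp
    show "(\<alpha> a, \<alpha>(a := 0)) \<in> (SIGMA k:{..d}. multi_idx_on S (d - k))"
      using \<alpha> S upd by (auto simp: multi_idx_on_def)
  qed
  finally show ?thesis by simp
qed

lemma finite_multi_idx_on:
  assumes "finite S"
  shows "finite (multi_idx_on S d)"
proof -
  let ?F = "{\<alpha>. \<forall>i. (i \<in> S \<longrightarrow> \<alpha> i \<in> {..d}) \<and> (i \<notin> S \<longrightarrow> \<alpha> i = 0)}"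
  have "multi_idx_on S d \<subseteq> ?F"
  proof
    fix \<alpha> assume \<alpha>: "\<alpha> \<in> multi_idx_on S d"
    have "\<alpha> i \<le> d" if "i \<in> S" for i
      using member_le_sum[OF that, of \<alpha>] assms \<alpha> by (auto simp: multi_idx_on_def)
    then show "\<alpha> \<in> ?F"
      using \<alpha> by (auto simp: multi_idx_on_def)
  qed
  then show ?thesis
    by (rule finite_subset) (rule finite_set_of_finite_funs[OF assms], simp)
qed

text \<open>Dividing by \<^term>\<open>fact d\<close> makes the summands products over the coordinates, so that
  the induction step is the binomial theorem.\<close>

lemma multinomial_theorem:
  fixes x :: "'n \<Rightarrow> real"
  assumes "finite S"
  shows "(\<Sum>i\<in>S. x i) ^ d / fact d = (\<Sum>\<alpha>\<in>multi_idx_on S d. \<Prod>i\<in>S. x i ^ \<alpha> i / fact (\<alpha> i))"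
  using assms
proof (induction S arbitrary: d)
  case empty
  have "multi_idx_on {} d = (if d = 0 then {\<lambda>_::'n. 0} else {})" by (auto simp: multi_idx_on_def)
  then show ?case by (auto simp: power_0_left)
next
  case (insert a S)
  have "(\<Sum>i\<in>insert a S. x i) ^ d / fact d
      = (\<Sum>k\<le>d. of_nat (d choose k) * x a ^ k * (\<Sum>i\<in>S. x i) ^ (d - k)) / fact d"
    using insert by (simp add: binomial_ring)
  also have "\<dots> = (\<Sum>k\<le>d. x a ^ k / fact k * ((\<Sum>i\<in>S. x i) ^ (d - k) / fact (d - k)))"
    unfolding sum_divide_distrib by (rule sum.cong) (auto simp: binomial_fact)
  also have "\<dots> = (\<Sum>k\<le>d. x a ^ k / fact k * (\<Sum>\<beta>\<in>multi_idx_on S (d - k). \<Prod>i\<in>S. x i ^ \<beta> i / fact (\<beta> i)))"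
    by (simp only: insert.IH)
  also have "\<dots> = (\<Sum>\<alpha>\<in>multi_idx_on (insert a S) d. \<Prod>i\<in>insert a S. x i ^ \<alpha> i / fact (\<alpha> i))"
    using insert by (subst sum_multi_idx_on_insert[where t = "\<lambda>i k. x i ^ k / fact k"]) (auto simp: finite_multi_idx_on)
  finally show ?case .
qed

lemma multi_idx_eq_multi_idx_on: "multi_idx d = multi_idx_on UNIV d"
  by (simp add: multi_idx_def multi_idx_on_def)

lemma finite_multi_idx [simp]: "finite (multi_idx d)"
  by (simp add: multi_idx_eq_multi_idx_on finite_multi_idx_on)

lemma multinomial_coeff_pos: "multinomial_coeff d \<alpha> > 0"
  by (simp add: multinomial_coeff_def prod_pos)

text \<open>Multi-indices are the count functions of multisets of size \<open>d\<close>, whose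
  number is known.\<close>

lemma card_multi_idx:
  "card (multi_idx d :: ('n::finite \<Rightarrow> nat) set) = (CARD('n) + d - 1) choose d"
proof -
  have size: "size M = sum (count M) UNIV" for M :: "'n multiset"
    unfolding size_multiset_overloaded_eq
    by (rule sum.mono_neutral_left) (auto simp: not_in_iff)
  have "\<alpha> \<in> count ` multisets_of_size UNIV d" if "\<alpha> \<in> multi_idx d" for \<alpha> :: "'n \<Rightarrow> nat"
  proof -
    have "count (Abs_multiset \<alpha>) = \<alpha>" by (simp add: Abs_multiset_inverse)
    then show ?thesis using that
      by (intro image_eqI[of _ _ "Abs_multiset \<alpha>"]) (auto simp: multisets_of_size_def size multi_idx_def)
  qed
  then have "multi_idx d = count ` multisets_of_size (UNIV :: 'n set) d"
    by (auto simp: multisets_of_size_def size multi_idx_def)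
  moreover have "inj_on count (multisets_of_size (UNIV :: 'n set) d)"
    by (auto simp: inj_on_def multiset_eq_iff)
  ultimately show ?thesis by (simp add: card_image card_multisets_of_size)
qed

lemma multi_idx_nonempty: "multi_idx d \<noteq> ({} :: ('n::finite \<Rightarrow> nat) set)"
proof -
  have "(\<lambda>i. if i = (SOME i::'n. True) then d else 0) \<in> multi_idx d"
    by (simp add: multi_idx_def)
  then show ?thesis by blast
qed

text \<open>This is what the square roots in \<open>lift_vec\<close> are for: in a product of two
  lifts they combine to the multinomial coefficient.\<close>

lemma dot_lift_vec:
  "dot_on (multi_idx d) (lift_vec d x) (lift_vec d y) = (x \<bullet> y) ^ d"
proof -
  have "dot_on (multi_idx d) (lift_vec d x) (lift_vec d y)
      = (\<Sum>\<alpha>\<in>multi_idx d. fact d * (\<Prod>i\<in>UNIV. (x $ i * y $ i) ^ \<alpha> i / fact (\<alpha> i)))"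
    unfolding dot_on_def
  proof (rule sum.cong[OF refl])
    fix \<alpha> :: "'a \<Rightarrow> nat"
    have "lift_vec d x \<alpha> * lift_vec d y \<alpha> = (sqrt (multinomial_coeff d \<alpha>))\<^sup>2
        * ((\<Prod>i\<in>UNIV. (x $ i) ^ \<alpha> i) * (\<Prod>i\<in>UNIV. (y $ i) ^ \<alpha> i))"
      by (simp add: lift_vec_def power2_eq_square)
    also have "\<dots> = multinomial_coeff d \<alpha> * (\<Prod>i\<in>UNIV. (x $ i * y $ i) ^ \<alpha> i)"
      by (simp add: less_imp_le[OF multinomial_coeff_pos] prod.distrib power_mult_distrib)
    also have "\<dots> = fact d * (\<Prod>i\<in>UNIV. (x $ i * y $ i) ^ \<alpha> i / fact (\<alpha> i))"
      by (simp add: multinomial_coeff_def prod_dividef)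
    finally show "lift_vec d x \<alpha> * lift_vec d y \<alpha>
      = fact d * (\<Prod>i\<in>UNIV. (x $ i * y $ i) ^ \<alpha> i / fact (\<alpha> i))" .
  qed
  also have "\<dots> = fact d * ((\<Sum>i\<in>UNIV. x $ i * y $ i) ^ d / fact d)"
    by (simp only: multinomial_theorem[OF finite] sum_distrib_left multi_idx_eq_multi_idx_on)
  also have "\<dots> = (x \<bullet> y) ^ d" by (simp add: inner_vec_def)
  finally show ?thesis .
qed

section \<open>Lifted vectors span the lifted space\<close>

text \<open>Halving one coordinate multiplies a monomial by a power of 2 that depends on its exponent
  there, so a combination of two evaluations eliminates any chosen competitor of \<^term>\<open>\<alpha>\<close>.\<close>

lemma coefficient_from_values:
  fixes S :: "('n::finite \<Rightarrow> nat) set"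
  assumes "finite S" "\<alpha> \<in> S"
  shows "\<exists>ps :: (real \<times> (real^'n)) list. (\<forall>(k, z)\<in>set ps. \<forall>i. \<bar>z $ i\<bar> \<le> 1) \<and>
    (\<forall>c. c \<alpha> = (\<Sum>(k, z)\<leftarrow>ps. k * (\<Sum>\<gamma>\<in>S. c \<gamma> * (\<Prod>i\<in>UNIV. (z $ i) ^ \<gamma> i))))"
  using assms
proof (induction "card S" arbitrary: S rule: less_induct)
  case less
  show ?case
  proof (cases "S = {\<alpha>}")
    case True
    \<comment> \<open>With a single monomial left, its value at the all-ones vector is the
      coefficient.\<close>
    then show ?thesis by (intro exI[of _ "[(1, \<chi> i. 1)]"]) simp
  next
    case False
    then obtain \<beta> where \<beta>: "\<beta> \<in> S" "\<beta> \<noteq> \<alpha>" using less.prems by blast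
    then obtain i where i: "\<beta> i \<noteq> \<alpha> i" by blast
    let ?m = "\<lambda>z \<gamma>. \<Prod>i\<in>UNIV. (z $ i) ^ \<gamma> i"
    have "card (S - {\<beta>}) < card S" using \<beta> less.prems by (intro psubset_card_mono) auto
    then obtain ps :: "(real \<times> (real^'n)) list"
      where cube: "\<forall>(k, z)\<in>set ps. \<forall>i. \<bar>z $ i\<bar> \<le> 1"
        and ps: "\<And>c. c \<alpha> = (\<Sum>(k, z)\<leftarrow>ps. k * (\<Sum>\<gamma>\<in>S - {\<beta>}. c \<gamma> * ?m z \<gamma>))"
      using less.hyps[of "S - {\<beta>}"] less.prems \<beta> by auto
    define h :: "real^'n \<Rightarrow> real^'n" where "h z = (\<chi> j. if j = i then z $ j / 2 else z $ j)" for z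
    have mh: "?m (h z) \<gamma> = ?m z \<gamma> / 2 ^ \<gamma> i" for z \<gamma>
    proof -
      have "?m (h z) \<gamma> = (h z $ i) ^ \<gamma> i * (\<Prod>j\<in>UNIV - {i}. (h z $ j) ^ \<gamma> j)"
        by (rule prod.remove) auto
      also have "(\<Prod>j\<in>UNIV - {i}. (h z $ j) ^ \<gamma> j) = (\<Prod>j\<in>UNIV - {i}. (z $ j) ^ \<gamma> j)"
        by (rule prod.cong) (auto simp: h_def)
      also have "(h z $ i) ^ \<gamma> i = (z $ i) ^ \<gamma> i / 2 ^ \<gamma> i"
        by (simp add: h_def power_divide)
      also have "(z $ i) ^ \<gamma> i / 2 ^ \<gamma> i * (\<Prod>j\<in>UNIV - {i}. (z $ j) ^ \<gamma> j) = ?m z \<gamma> / 2 ^ \<gamma> i"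
        by (subst prod.remove[of UNIV i]) auto
      finally show ?thesis .
    qed
    \<comment> \<open>The combination \<open>2 ^ \<beta> i\<close> times the value at
      \<open>h z\<close> minus the value at \<open>z\<close> multiplies the \<open>\<gamma>\<close>
      term by \<open>\<kappa> \<gamma>\<close>. This is zero at \<open>\<beta>\<close>, and nonzero
      at \<open>\<alpha>\<close> because the exponents at \<open>i\<close> differ.\<close>
    define \<kappa> :: "('n \<Rightarrow> nat) \<Rightarrow> real" where "\<kappa> \<gamma> = 2 ^ \<beta> i / 2 ^ \<gamma> i - 1" for \<gamma>
    have \<kappa>: "\<kappa> \<alpha> \<noteq> 0" using i by (simp add: \<kappa>_def field_simps)
    have elim: "(\<Sum>\<gamma>\<in>S - {\<beta>}. \<kappa> \<gamma> * c \<gamma> * ?m z \<gamma>)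
       = 2 ^ \<beta> i * (\<Sum>\<gamma>\<in>S. c \<gamma> * ?m (h z) \<gamma>) - (\<Sum>\<gamma>\<in>S. c \<gamma> * ?m z \<gamma>)" for c z
    proof -
      have "(\<Sum>\<gamma>\<in>S - {\<beta>}. \<kappa> \<gamma> * c \<gamma> * ?m z \<gamma>) = (\<Sum>\<gamma>\<in>S. \<kappa> \<gamma> * c \<gamma> * ?m z \<gamma>)"
        by (rule sum.mono_neutral_left) (use less.prems in \<open>auto simp: \<kappa>_def\<close>)
      also have "\<dots> = (\<Sum>\<gamma>\<in>S. 2 ^ \<beta> i * (c \<gamma> * ?m (h z) \<gamma>) - c \<gamma> * ?m z \<gamma>)"
        by (rule sum.cong) (auto simp: mh \<kappa>_def field_simps)
      also have "\<dots> = 2 ^ \<beta> i * (\<Sum>\<gamma>\<in>S. c \<gamma> * ?m (h z) \<gamma>) - (\<Sum>\<gamma>\<in>S. c \<gamma> * ?m z \<gamma>)"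
        by (simp only: sum_subtractf sum_distrib_left)
      finally show ?thesis .
    qed
    let ?ps = "map (\<lambda>(k, z). (k * 2 ^ \<beta> i / \<kappa> \<alpha>, h z)) ps @ map (\<lambda>(k, z). (- k / \<kappa> \<alpha>, z)) ps"
    have "c \<alpha> = (\<Sum>(k, z)\<leftarrow>?ps. k * (\<Sum>\<gamma>\<in>S. c \<gamma> * ?m z \<gamma>))" for c
    proof -
      have "c \<alpha> = (\<Sum>(k, z)\<leftarrow>ps. k * (\<Sum>\<gamma>\<in>S - {\<beta>}. \<kappa> \<gamma> * c \<gamma> * ?m z \<gamma>)) / \<kappa> \<alpha>"
        using ps[of "\<lambda>\<gamma>. \<kappa> \<gamma> * c \<gamma>"] \<kappa> by (simp add: field_simps)
      also have "\<dots> = (\<Sum>(k, z)\<leftarrow>?ps. k * (\<Sum>\<gamma>\<in>S. c \<gamma> * ?m z \<gamma>))"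
        unfolding elim by (induction ps) (auto simp: field_simps \<kappa>)
      finally show ?thesis .
    qed
    moreover have "\<forall>(k, z)\<in>set ?ps. \<forall>j. \<bar>z $ j\<bar> \<le> 1"
    proof -
      have "\<bar>h z $ j\<bar> \<le> 1" if "\<And>j. \<bar>z $ j\<bar> \<le> 1" for z j
        using that[of j] by (auto simp: h_def)
      then show ?thesis using cube by auto
    qed
    ultimately show ?thesis by blast
  qed
qed

text \<open>The pairing with \<open>lift_vec d z\<close> is a polynomial in \<open>z\<close> with
  coefficients \<open>x \<gamma>\<close> up to fixed nonzero weights. The nodes in \<open>ps\<close>
  do not depend on \<open>x\<close>, and their confinement to the cube yields uniform bounds
  later.\<close>

lemma coordinate_from_lifts:
  assumes "\<alpha> \<in> multi_idx d"
  shows "\<exists>ps :: (real \<times> (real^'n)) list. (\<forall>(k, z)\<in>set ps. \<forall>i. \<bar>z $ i\<bar> \<le> 1) \<and>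
    (\<forall>x. x \<alpha> = (\<Sum>(k, z)\<leftarrow>ps. k * dot_on (multi_idx d) (lift_vec d z) x))"
proof -
  let ?s = "\<lambda>\<gamma>. sqrt (multinomial_coeff d \<gamma>)"
  obtain ps :: "(real \<times> (real^'n)) list" where cube: "\<forall>(k, z)\<in>set ps. \<forall>i. \<bar>z $ i\<bar> \<le> 1"
    and ps: "\<And>c. c \<alpha> = (\<Sum>(k, z)\<leftarrow>ps. k * (\<Sum>\<gamma>\<in>multi_idx d. c \<gamma> * (\<Prod>i\<in>UNIV. (z $ i) ^ \<gamma> i)))"
    using coefficient_from_values[OF finite_multi_idx assms] by blast
  let ?ps = "map (\<lambda>(k, z). (k / ?s \<alpha>, z)) ps"
  have s: "?s \<alpha> \<noteq> 0" using multinomial_coeff_pos[of d \<alpha>] by simp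
  have "x \<alpha> = (\<Sum>(k, z)\<leftarrow>?ps. k * dot_on (multi_idx d) (lift_vec d z) x)" for x
  proof -
    have "x \<alpha> = (\<Sum>(k, z)\<leftarrow>ps. k * (\<Sum>\<gamma>\<in>multi_idx d. ?s \<gamma> * x \<gamma> * (\<Prod>i\<in>UNIV. (z $ i) ^ \<gamma> i))) / ?s \<alpha>"
      using ps[of "\<lambda>\<gamma>. ?s \<gamma> * x \<gamma>"] s by (simp add: field_simps)
    also have "(\<lambda>z. \<Sum>\<gamma>\<in>multi_idx d. ?s \<gamma> * x \<gamma> * (\<Prod>i\<in>UNIV. (z $ i) ^ \<gamma> i))
        = (\<lambda>z. dot_on (multi_idx d) (lift_vec d z) x)"
      by (simp add: dot_on_def lift_vec_def fun_eq_iff mult_ac)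
    also have "(\<Sum>(k, z)\<leftarrow>ps. k * dot_on (multi_idx d) (lift_vec d z) x) / ?s \<alpha>
        = (\<Sum>(k, z)\<leftarrow>?ps. k * dot_on (multi_idx d) (lift_vec d z) x)"
      by (induction ps) (auto simp: add_divide_distrib)
    finally show ?thesis .
  qed
  moreover have "\<forall>(k, z)\<in>set ?ps. \<forall>i. \<bar>z $ i\<bar> \<le> 1" using cube by fastforce
  ultimately show ?thesis by blast
qed

text \<open>Each coordinate is a combination of pairings with lifts. Hence identities in the lifted
  space may be tested against lifts alone.\<close>

lemma lift_vec_separates:
  fixes x :: "('n::finite \<Rightarrow> nat) \<Rightarrow> real"
  assumes "\<And>z :: real^'n. dot_on (multi_idx d) (lift_vec d z) x = 0" "\<alpha> \<in> multi_idx d"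
  shows "x \<alpha> = 0"
proof -
  obtain ps :: "(real \<times> (real^'n)) list"
    where "x \<alpha> = (\<Sum>(k, z)\<leftarrow>ps. k * dot_on (multi_idx d) (lift_vec d z) x)"
    using coordinate_from_lifts[OF assms(2)] by blast
  then show ?thesis by (simp add: assms(1) case_prod_unfold)
qed

section \<open>The lifted matrix\<close>

lemma dot_on_sum_list:
  "dot_on I (\<lambda>i. \<Sum>p\<leftarrow>ps. f p i) x = (\<Sum>p\<leftarrow>ps. dot_on I (f p) x)"
  by (induction ps) (auto simp: dot_on_def algebra_simps sum.distrib)

text \<open>Expand coordinate \<open>\<alpha>\<close> of the lift of \<open>A *v x\<close> into
  pairings with lifts of nodes \<open>z\<close>. Each pairing equals the one of the lift of
  \<open>z v* A\<close> with the lift of \<open>x\<close>, so row \<open>\<alpha>\<close> is a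
  combination of such lifts.\<close>

lemma lift_mat_exists:
  fixes A :: "real^'n^'n"
  shows "\<exists>B. (\<forall>\<alpha> \<beta>. (\<alpha> \<notin> multi_idx d \<or> \<beta> \<notin> multi_idx d) \<longrightarrow> B \<alpha> \<beta> = 0) \<and>
      (\<forall>x. \<forall>\<alpha>\<in>multi_idx d. (\<Sum>\<beta>\<in>multi_idx d. B \<alpha> \<beta> * lift_vec d x \<beta>) = lift_vec d (A *v x) \<alpha>)"
proof -
  let ?I = "multi_idx d :: ('n \<Rightarrow> nat) set"
  have "\<exists>b. \<forall>x. dot_on ?I b (lift_vec d x) = lift_vec d (A *v x) \<alpha>" if \<alpha>: "\<alpha> \<in> ?I" for \<alpha>
  proof -
    obtain ps :: "(real \<times> (real^'n)) list"
      where ps: "\<And>x. x \<alpha> = (\<Sum>(k, z)\<leftarrow>ps. k * dot_on ?I (lift_vec d z) x)"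
      using coordinate_from_lifts[OF \<alpha>] by blast
    let ?b = "\<lambda>\<beta>. \<Sum>p\<leftarrow>ps. fst p * lift_vec d (snd p v* A) \<beta>"
    have "dot_on ?I ?b (lift_vec d x) = lift_vec d (A *v x) \<alpha>" for x
    proof -
      have "dot_on ?I ?b (lift_vec d x)
          = (\<Sum>p\<leftarrow>ps. fst p * dot_on ?I (lift_vec d (snd p v* A)) (lift_vec d x))"
        unfolding dot_on_sum_list by (simp add: dot_on_def sum_distrib_left mult.assoc)
      also have "\<dots> = (\<Sum>p\<leftarrow>ps. fst p * dot_on ?I (lift_vec d (snd p)) (lift_vec d (A *v x)))"
        by (simp add: dot_lift_vec dot_lmul_matrix)
      also have "\<dots> = lift_vec d (A *v x) \<alpha>"
        by (subst ps) (simp add: case_prod_unfold)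
      finally show ?thesis .
    qed
    then show ?thesis by blast
  qed
  then obtain b where b: "\<And>\<alpha> x. \<alpha> \<in> ?I \<Longrightarrow> dot_on ?I (b \<alpha>) (lift_vec d x) = lift_vec d (A *v x) \<alpha>"
    by metis
  let ?B = "\<lambda>\<alpha> \<beta>. if \<alpha> \<in> ?I \<and> \<beta> \<in> ?I then b \<alpha> \<beta> else 0"
  have "(\<Sum>\<beta>\<in>?I. ?B \<alpha> \<beta> * lift_vec d x \<beta>) = lift_vec d (A *v x) \<alpha>" if "\<alpha> \<in> ?I" for x \<alpha>
    using b[OF that, of x] that by (simp add: dot_on_def)
  then show ?thesis by (intro exI[of _ ?B]) auto
qed

text \<open>The \<open>THE\<close> in the definition is justified by existence and by uniqueness:
  the difference of two candidate rows is orthogonal to all lifts.\<close>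

lemma lift_mat_apply:
  fixes A :: "real^'n^'n"
  assumes "\<alpha> \<in> multi_idx d"
  shows "mapply (multi_idx d) (lift_mat d A) (lift_vec d x) \<alpha> = lift_vec d (A *v x) \<alpha>"
proof -
  let ?I = "multi_idx d :: ('n \<Rightarrow> nat) set"
  let ?P = "\<lambda>B. (\<forall>\<alpha> \<beta>. (\<alpha> \<notin> ?I \<or> \<beta> \<notin> ?I) \<longrightarrow> B \<alpha> \<beta> = 0) \<and>
      (\<forall>x. \<forall>\<alpha>\<in>?I. (\<Sum>\<beta>\<in>?I. B \<alpha> \<beta> * lift_vec d x \<beta>) = lift_vec d (A *v x) \<alpha>)"
  have uniq: "B = C" if B: "?P B" and C: "?P C" for B C
  proof (intro ext)
    fix \<alpha> \<beta>
    show "B \<alpha> \<beta> = C \<alpha> \<beta>"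
    proof (cases "\<alpha> \<in> ?I \<and> \<beta> \<in> ?I")
      case True
      have "B \<alpha> \<beta> - C \<alpha> \<beta> = 0"
      proof (rule lift_vec_separates[where d = d and x = "\<lambda>\<beta>. B \<alpha> \<beta> - C \<alpha> \<beta>"])
        fix z :: "real^'n"
        have "dot_on ?I (lift_vec d z) (\<lambda>\<beta>. B \<alpha> \<beta> - C \<alpha> \<beta>)
           = (\<Sum>\<beta>\<in>?I. B \<alpha> \<beta> * lift_vec d z \<beta>) - (\<Sum>\<beta>\<in>?I. C \<alpha> \<beta> * lift_vec d z \<beta>)"
          by (simp add: dot_on_def sum_subtractf algebra_simps)
        also have "\<dots> = 0" using B C True by simp
        finally show "dot_on ?I (lift_vec d z) (\<lambda>\<beta>. B \<alpha> \<beta> - C \<alpha> \<beta>) = 0" .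
      qed (use True in simp)
      then show ?thesis by simp
    next
      case False
      then show ?thesis using B C by auto
    qed
  qed
  obtain B where B: "?P B" using lift_mat_exists by blast
  have "lift_mat d A = B"
    unfolding lift_mat_def using B uniq[OF _ B] by (rule the_equality)
  then show ?thesis using B assms by (simp add: mapply_def)
qed

text \<open>For \<open>x\<close> a lift this is the adjoint identity in the original space; it
  extends to every \<open>x\<close> since the lifts span. The Lyapunov inequality needs it for every
  \<open>x\<close>.\<close>

lemma dot_lift_mat:
  fixes A :: "real^'n^'n"
  shows "dot_on (multi_idx d) (lift_vec d y) (mapply (multi_idx d) (lift_mat d A) x)
       = dot_on (multi_idx d) (lift_vec d (y v* A)) x"
proof -
  let ?I = "multi_idx d :: ('n \<Rightarrow> nat) set"
  define row where "row \<gamma> = (\<Sum>\<beta>\<in>?I. lift_vec d y \<beta> * lift_mat d A \<beta> \<gamma>)" for \<gamma>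
  have row: "dot_on ?I (lift_vec d y) (mapply ?I (lift_mat d A) x) = dot_on ?I row x" for x
  proof -
    have "dot_on ?I (lift_vec d y) (mapply ?I (lift_mat d A) x)
        = (\<Sum>\<beta>\<in>?I. \<Sum>\<gamma>\<in>?I. lift_vec d y \<beta> * lift_mat d A \<beta> \<gamma> * x \<gamma>)"
      by (simp add: dot_on_def mapply_def sum_distrib_left mult.assoc)
    also have "\<dots> = (\<Sum>\<gamma>\<in>?I. \<Sum>\<beta>\<in>?I. lift_vec d y \<beta> * lift_mat d A \<beta> \<gamma> * x \<gamma>)"
      by (rule sum.swap)
    also have "\<dots> = dot_on ?I row x" by (simp add: dot_on_def row_def sum_distrib_right)
    finally show ?thesis .
  qed
  have "row \<gamma> = lift_vec d (y v* A) \<gamma>" if "\<gamma> \<in> ?I" for \<gamma>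
  proof -
    have "row \<gamma> - lift_vec d (y v* A) \<gamma> = 0"
    proof (rule lift_vec_separates[OF _ that])
      fix z :: "real^'n"
      have "dot_on ?I (lift_vec d z) (\<lambda>\<gamma>. row \<gamma> - lift_vec d (y v* A) \<gamma>)
        = dot_on ?I row (lift_vec d z) - dot_on ?I (lift_vec d (y v* A)) (lift_vec d z)"
        by (simp add: dot_on_def sum_subtractf algebra_simps)
      also have "dot_on ?I row (lift_vec d z) = dot_on ?I (lift_vec d y) (lift_vec d (A *v z))"
        unfolding row[symmetric] by (simp add: dot_on_def lift_mat_apply)
      finally show "dot_on ?I (lift_vec d z) (\<lambda>\<gamma>. row \<gamma> - lift_vec d (y v* A) \<gamma>) = 0"
        by (simp add: dot_lift_vec dot_lmul_matrix)
    qed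
    then show ?thesis by simp
  qed
  then show ?thesis unfolding row by (simp add: dot_on_def)
qed

lemma lift_vec_scaleR:
  assumes "\<alpha> \<in> multi_idx d"
  shows "lift_vec d (r *\<^sub>R x) \<alpha> = r ^ d * lift_vec d x \<alpha>"
proof -
  have "(\<Prod>i\<in>UNIV. r ^ \<alpha> i) = r ^ d"
    using assms by (simp add: multi_idx_def power_sum[symmetric])
  then show ?thesis by (simp add: lift_vec_def power_mult_distrib prod.distrib)
qed

lemma lift_vec_bound:
  fixes y :: "real^'n"
  assumes "\<alpha> \<in> multi_idx d"
  shows "\<bar>lift_vec d y \<alpha>\<bar> \<le> norm y ^ d"
proof -
  have "(lift_vec d y \<alpha>)\<^sup>2 \<le> dot_on (multi_idx d) (lift_vec d y) (lift_vec d y)"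
    unfolding dot_on_def power2_eq_square[symmetric] using assms by (intro member_le_sum) auto
  also have "\<dots> = (norm y ^ d)\<^sup>2"
    by (simp add: dot_lift_vec dot_square_norm power_mult[symmetric] mult.commute)
  finally show ?thesis by (simp add: abs_le_square_iff[symmetric])
qed

text \<open>Quantitative spanning: finitely many fixed nodes of the cube recover all coordinates, so
  their weights give a \<open>\<delta>\<close> independent of \<open>x\<close>.\<close>

lemma lift_cube_spanning:
  "\<exists>\<delta>>0. \<forall>x s. (\<forall>z :: real^'n. (\<forall>i. \<bar>z $ i\<bar> \<le> 1) \<longrightarrow> (dot_on (multi_idx d) (lift_vec d z) x)\<^sup>2 \<le> s)
      \<longrightarrow> \<delta> * dot_on (multi_idx d) x x \<le> s"
proof -
  let ?I = "multi_idx d :: ('n \<Rightarrow> nat) set"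
  define R where "R \<alpha> ps \<longleftrightarrow> (\<forall>(k, z)\<in>set ps. \<forall>i. \<bar>z $ i\<bar> \<le> 1) \<and>
    (\<forall>x. x \<alpha> = (\<Sum>(k, z)\<leftarrow>ps. k * dot_on ?I (lift_vec d z) x))"
    for \<alpha> and ps :: "(real \<times> (real^'n)) list"
  have "\<forall>\<alpha>\<in>?I. \<exists>ps. R \<alpha> ps"
    unfolding R_def using coordinate_from_lifts by blast
  then obtain ps where R: "\<forall>\<alpha>\<in>?I. R \<alpha> (ps \<alpha>)" by (rule bchoice[THEN exE])
  have cube: "\<bar>z $ i\<bar> \<le> 1" if "\<alpha> \<in> ?I" "(k, z) \<in> set (ps \<alpha>)" for \<alpha> k z i
    using R that unfolding R_def by blast
  have ps: "x \<alpha> = (\<Sum>(k, z)\<leftarrow>ps \<alpha>. k * dot_on ?I (lift_vec d z) x)" if "\<alpha> \<in> ?I" for \<alpha> x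
    using R that unfolding R_def by blast
  define w where "w \<alpha> = (\<Sum>p\<leftarrow>ps \<alpha>. \<bar>fst p\<bar>)" for \<alpha>
  define W where "W = 1 + (\<Sum>\<alpha>\<in>?I. (w \<alpha>)\<^sup>2)"
  have W: "W > 0" unfolding W_def by (intro add_pos_nonneg sum_nonneg) auto
  have "1 / W * dot_on ?I x x \<le> s"
    if *: "\<And>z :: real^'n. (\<forall>i. \<bar>z $ i\<bar> \<le> 1) \<Longrightarrow> (dot_on ?I (lift_vec d z) x)\<^sup>2 \<le> s" for x s
  proof -
    \<comment> \<open>The node 0 belongs to the cube, so \<open>s\<close> bounds a square.\<close>
    have s: "s \<ge> 0" using order_trans[OF zero_le_power2 *[of 0]] by simp
    have xw: "\<bar>x \<alpha>\<bar> \<le> w \<alpha> * sqrt s" if \<alpha>: "\<alpha> \<in> ?I" for \<alpha>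
    proof -
      have le: "\<bar>dot_on ?I (lift_vec d (snd p)) x\<bar> \<le> sqrt s" if "p \<in> set (ps \<alpha>)" for p
        using *[of "snd p"] cube[OF \<alpha>, of "fst p" "snd p"] that by (simp add: real_le_rsqrt)
      have "\<bar>x \<alpha>\<bar> = \<bar>\<Sum>p\<leftarrow>ps \<alpha>. fst p * dot_on ?I (lift_vec d (snd p)) x\<bar>"
        using ps[OF \<alpha>, of x] by (simp add: case_prod_unfold)
      also have "\<dots> \<le> (\<Sum>p\<leftarrow>ps \<alpha>. \<bar>fst p * dot_on ?I (lift_vec d (snd p)) x\<bar>)"
        using sum_list_abs[of "map (\<lambda>p. fst p * dot_on ?I (lift_vec d (snd p)) x) (ps \<alpha>)"] by (simp add: o_def)
      also have "\<dots> \<le> (\<Sum>p\<leftarrow>ps \<alpha>. \<bar>fst p\<bar> * sqrt s)"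
        by (rule sum_list_mono) (simp add: abs_mult mult_left_mono le)
      also have "\<dots> = w \<alpha> * sqrt s" by (simp add: w_def sum_list_mult_const)
      finally show ?thesis .
    qed
    have "dot_on ?I x x \<le> (\<Sum>\<alpha>\<in>?I. (w \<alpha>)\<^sup>2 * s)"
      unfolding dot_on_def
    proof (rule sum_mono)
      fix \<alpha> assume \<alpha>: "\<alpha> \<in> ?I"
      have "x \<alpha> * x \<alpha> = \<bar>x \<alpha>\<bar>\<^sup>2" by (simp add: power2_eq_square)
      also have "\<dots> \<le> (w \<alpha> * sqrt s)\<^sup>2" by (rule power_mono[OF xw[OF \<alpha>]]) simp
      finally show "x \<alpha> * x \<alpha> \<le> (w \<alpha>)\<^sup>2 * s" using s by (simp add: power_mult_distrib)
    qed
    also have "\<dots> \<le> W * s"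
      unfolding W_def sum_distrib_right[symmetric] using s by (simp add: distrib_right)
    finally show ?thesis using W by (simp add: field_simps)
  qed
  then show ?thesis using W by (intro exI[of _ "1 / W"]) simp
qed

section \<open>An almost optimal ellipsoid\<close>

text \<open>The size \<open>m\<close> will be the cardinality of an index set depending on
  \<open>d\<close>, so it is a number and not a type.\<close>

definition idx_det :: "nat \<Rightarrow> (nat \<Rightarrow> nat \<Rightarrow> real) \<Rightarrow> real" where
  "idx_det m L = Determinant.det (Matrix.mat m m (\<lambda>(i, j). L i j))"

lemma idx_det_cong:
  assumes "\<And>i j. i < m \<Longrightarrow> j < m \<Longrightarrow> L i j = L' i j"
  shows "idx_det m L = idx_det m L'"
proof -
  have "Matrix.mat m m (\<lambda>(i, j). L i j) = Matrix.mat m m (\<lambda>(i, j). L' i j)"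
    by (rule eq_matI) (use assms in auto)
  then show ?thesis by (simp add: idx_det_def)
qed

lemma idx_det_mult:
  "idx_det m (\<lambda>i j. \<Sum>k<m. A i k * B k j) = idx_det m A * idx_det m B"
proof -
  have "Matrix.mat m m (\<lambda>(i, j). \<Sum>k<m. A i k * B k j)
      = Matrix.mat m m (\<lambda>(i, j). A i j) * Matrix.mat m m (\<lambda>(i, j). B i j)"
    by (rule eq_matI) (auto simp: scalar_prod_def atLeast0LessThan)
  then show ?thesis
    unfolding idx_det_def by (simp add: det_mult[of _ m])
qed

lemma idx_det_diag:
  "idx_det m (\<lambda>i j. if i = j then D i else 0) = (\<Prod>i<m. D i)"
proof -
  let ?M = "Matrix.mat m m (\<lambda>(i, j). if i = j then D i else 0)"
  have "upper_triangular ?M" by auto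
  then have "Determinant.det ?M = prod_list (diag_mat ?M)"
    by (rule det_upper_triangular) auto
  also have "\<dots> = (\<Prod>i = 0..<m. D i)"
    by (simp add: prod_list_diag_prod)
  finally show ?thesis by (simp add: idx_det_def atLeast0LessThan)
qed

lemma permutes_nat_less: "p permutes {0..<m} \<Longrightarrow> i < m \<Longrightarrow> p i < (m::nat)"
  using permutes_in_image[of p "{0..<m}" i] by simp

text \<open>The Leibniz formula has \<open>fact m\<close> terms with \<open>m\<close> factors each.
  This crude bound is enough for a supremum of determinants to exist.\<close>

lemma idx_det_bound:
  assumes "\<And>i j. i < m \<Longrightarrow> j < m \<Longrightarrow> \<bar>L i j\<bar> \<le> K"
  shows "\<bar>idx_det m L\<bar> \<le> fact m * K ^ m"
proof -
  have "idx_det m L = (\<Sum>p | p permutes {0..<m}. of_int (sign p) * (\<Prod>i = 0..<m. L i (p i)))"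
    unfolding idx_det_def Determinant.det_def
    by (auto intro!: sum.cong prod.cong simp: permutes_nat_less)
  also have "\<bar>\<dots>\<bar> \<le> (\<Sum>p | p permutes {0..<m}. \<bar>of_int (sign p) * (\<Prod>i = 0..<m. L i (p i))\<bar>)"
    by (rule sum_abs)
  also have "\<dots> \<le> (\<Sum>p | p permutes {0..<m}. K ^ m)"
  proof (rule sum_mono)
    fix p assume "p \<in> {p. p permutes {0..<m}}"
    then have p: "p permutes {0..<m}" by simp
    have "\<bar>\<Prod>i = 0..<m. L i (p i)\<bar> = (\<Prod>i = 0..<m. \<bar>L i (p i)\<bar>)" by (rule abs_prod)
    also have "\<dots> \<le> (\<Prod>i = 0..<m. K)"
      by (rule prod_mono) (use assms p in \<open>auto simp: permutes_nat_less\<close>)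
    finally show "\<bar>of_int (sign p) * (\<Prod>i = 0..<m. L i (p i))\<bar> \<le> K ^ m"
      by (simp add: abs_mult sign_def)
  qed
  also have "\<dots> = fact m * K ^ m"
    by (simp add: card_permutations[OF refl])
  finally show ?thesis .
qed

text \<open>The adjugate divided by the determinant inverts \<open>L\<close>; \<open>w\<close> is
  \<open>u\<close> times this inverse.\<close>

lemma idx_det_nonzero_solve:
  assumes "idx_det m L \<noteq> 0"
  shows "\<exists>w. \<forall>j<m. u j = (\<Sum>k<m. w k * L k j)"
proof -
  let ?M = "Matrix.mat m m (\<lambda>(i, j). L i j)"
  let ?c = "idx_det m L"
  have M: "?M \<in> carrier_mat m m" by simp
  have adj: "adj_mat ?M * ?M = ?c \<cdot>\<^sub>m 1\<^sub>m m" "adj_mat ?M \<in> carrier_mat m m"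
    using adj_mat[OF M] by (auto simp: idx_det_def)
  define N where "N i k = adj_mat ?M $$ (i, k)" for i k
  have id: "(\<Sum>k<m. N i k * L k j) = (if i = j then ?c else 0)" if "i < m" "j < m" for i j
  proof -
    have "(adj_mat ?M * ?M) $$ (i, j) = (?c \<cdot>\<^sub>m 1\<^sub>m m) $$ (i, j)" using adj by simp
    then show ?thesis
      using that adj(2) by (auto simp: scalar_prod_def N_def atLeast0LessThan)
  qed
  define w where "w k = (\<Sum>i<m. u i * N i k) / ?c" for k
  have "u j = (\<Sum>k<m. w k * L k j)" if "j < m" for j
  proof -
    have "(\<Sum>k<m. w k * L k j) = (\<Sum>k<m. \<Sum>i<m. u i * N i k * L k j / ?c)"
      by (simp add: w_def sum_distrib_right sum_divide_distrib)
    also have "\<dots> = (\<Sum>i<m. \<Sum>k<m. u i * N i k * L k j / ?c)" by (rule sum.swap)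
    also have "\<dots> = (\<Sum>i<m. u i * (\<Sum>k<m. N i k * L k j) / ?c)"
      by (simp add: sum_distrib_left sum_divide_distrib mult.assoc)
    also have "\<dots> = (\<Sum>i<m. u i * (if i = j then ?c else 0) / ?c)"
      using id that by (intro sum.cong) auto
    also have "\<dots> = (\<Sum>i<m. if i = j then u i else 0)"
      by (rule sum.cong) (use assms in auto)
    also have "\<dots> = u j" using that by simp
    finally show ?thesis by simp
  qed
  then show ?thesis by blast
qed

section \<open>Reflections and rank-one updates\<close>

text \<open>The Householder reflection in the hyperplane orthogonal to \<open>v\<close>.\<close>

definition reflect :: "nat \<Rightarrow> (nat \<Rightarrow> real) \<Rightarrow> nat \<Rightarrow> nat \<Rightarrow> real" where
  "reflect m v i j = (if i = j then 1 else 0) - 2 / dot_on {..<m} v v * v i * v j"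

lemma mapply_reflect:
  assumes "i < m"
  shows "mapply {..<m} (reflect m v) y i = y i - 2 / dot_on {..<m} v v * dot_on {..<m} v y * v i"
proof -
  have "mapply {..<m} (reflect m v) y i
      = (\<Sum>j<m. (if i = j then y j else 0) - 2 / dot_on {..<m} v v * v i * (v j * y j))"
    unfolding mapply_def reflect_def by (rule sum.cong) (auto simp: algebra_simps)
  also have "\<dots> = y i - 2 / dot_on {..<m} v v * v i * dot_on {..<m} v y"
    using assms by (simp add: sum_subtractf dot_on_def[of _ v y] sum_distrib_left sum_divide_distrib)
  finally show ?thesis by simp
qed

lemma dot_reflect:
  assumes "dot_on {..<m} v v \<noteq> 0"
  shows "dot_on {..<m} (mapply {..<m} (reflect m v) x) (mapply {..<m} (reflect m v) y)
       = dot_on {..<m} x y"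
proof -
  let ?q = "dot_on {..<m} v v" and ?a = "dot_on {..<m} v x" and ?b = "dot_on {..<m} v y"
  have "dot_on {..<m} (mapply {..<m} (reflect m v) x) (mapply {..<m} (reflect m v) y)
      = (\<Sum>i<m. (x i - 2 / ?q * ?a * v i) * (y i - 2 / ?q * ?b * v i))"
    unfolding dot_on_def[of _ "mapply _ _ _"] by (rule sum.cong) (auto simp: mapply_reflect)
  also have "\<dots> = (\<Sum>i<m. x i * y i - 2 / ?q * ?b * (v i * x i) - 2 / ?q * ?a * (v i * y i)
      + 4 * ?a * ?b / (?q * ?q) * (v i * v i))"
    by (rule sum.cong) (auto simp: algebra_simps)
  also have "\<dots> = dot_on {..<m} x y - 2 / ?q * ?b * ?a - 2 / ?q * ?a * ?b
      + 4 * ?a * ?b / (?q * ?q) * ?q"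
    unfolding sum.distrib sum_subtractf sum_distrib_left[symmetric] dot_on_def ..
  also have "\<dots> = dot_on {..<m} x y" using assms by (simp add: field_simps)
  finally show ?thesis .
qed

text \<open>The reflection is symmetric and preserves inner products, so its square is the identity.
  Squaring spares the sign of the determinant.\<close>

lemma idx_det_reflect_sq:
  assumes "dot_on {..<m} v v \<noteq> 0"
  shows "(idx_det m (reflect m v))\<^sup>2 = 1"
proof -
  let ?R = "reflect m v"
  let ?e = "\<lambda>i j. if j = i then 1 else (0::real)"
  have "(\<Sum>k<m. ?R i k * ?R k j) = (if i = j then 1 else 0)" if "i < m" "j < m" for i j
  proof -
    have col: "mapply {..<m} ?R (?e i) k = ?R k i" if "i < m" for i k
      using that by (simp add: mapply_def if_distrib[of "\<lambda>x. _ * x"] cong: if_cong)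
    have "(\<Sum>k<m. ?R i k * ?R k j)
        = dot_on {..<m} (mapply {..<m} ?R (?e i)) (mapply {..<m} ?R (?e j))"
      unfolding dot_on_def using that by (intro sum.cong) (auto simp: col reflect_def)
    also have "\<dots> = dot_on {..<m} (?e i) (?e j)" by (rule dot_reflect[OF assms])
    also have "\<dots> = (\<Sum>k<m. if k = i then (if i = j then 1 else 0) else 0)"
      unfolding dot_on_def by (rule sum.cong) auto
    also have "\<dots> = (if i = j then 1 else 0)" using that by simp
    finally show ?thesis .
  qed
  then have "idx_det m (\<lambda>i j. \<Sum>k<m. ?R i k * ?R k j) = idx_det m (\<lambda>i j. if i = j then 1 else 0)"
    by (intro idx_det_cong) auto
  then show ?thesis
    by (simp add: idx_det_mult idx_det_diag power2_eq_square)
qed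

lemma mapply_mult:
  "mapply I (\<lambda>i j. \<Sum>k\<in>I. A i k * B k j) x i = mapply I A (mapply I B x) i"
proof -
  have "mapply I (\<lambda>i j. \<Sum>k\<in>I. A i k * B k j) x i = (\<Sum>j\<in>I. \<Sum>k\<in>I. A i k * B k j * x j)"
    by (simp add: mapply_def sum_distrib_right)
  also have "\<dots> = (\<Sum>k\<in>I. \<Sum>j\<in>I. A i k * B k j * x j)" by (rule sum.swap)
  also have "\<dots> = mapply I A (mapply I B x) i"
    by (simp add: mapply_def sum_distrib_left mult.assoc)
  finally show ?thesis .
qed

text \<open>The reflection that takes \<^term>\<open>w\<close> to a multiple of the first basis vector turns the rank-one
  update into a rescaling of the coordinates, which makes the determinant explicit.\<close>

lemma frame_rank_one_update:
  assumes m: "m > 0" and b: "0 < b" "b < 1"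
    and w: "\<And>j. j < m \<Longrightarrow> u j = (\<Sum>k<m. w k * L k j)"
    and c: "dot_on {..<m} w w = c" "c > 0"
  shows "\<exists>L'. (\<forall>x. dot_on {..<m} (mapply {..<m} L' x) (mapply {..<m} L' x)
             = (1 - b) * dot_on {..<m} (mapply {..<m} L x) (mapply {..<m} L x)
               + b * (dot_on {..<m} u x)\<^sup>2)
        \<and> (idx_det m L')\<^sup>2 = (1 - b) ^ (m - 1) * (1 - b + b * c) * (idx_det m L)\<^sup>2"
proof -
  let ?I = "{..<m}"
  define s where "s = (if w 0 \<le> 0 then sqrt c else - sqrt c)"
  \<comment> \<open>The sign keeps \<open>v\<close> below away from zero.\<close>
  have s2: "s * s = c" using c by (auto simp: s_def)
  have sw: "s * w 0 \<le> 0" using c by (auto simp: s_def mult_nonneg_nonpos)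
  define v where "v i = w i - (if i = 0 then s else 0)" for i
  have m0: "(\<Sum>i<m. if i = 0 then f i else 0) = f 0" for f :: "nat \<Rightarrow> real"
    using m by simp
  have vy: "dot_on ?I v y = dot_on ?I w y - s * y 0" for y
  proof -
    have "dot_on ?I v y = (\<Sum>i<m. w i * y i - (if i = 0 then s * y i else 0))"
      unfolding dot_on_def v_def by (rule sum.cong) (auto simp: algebra_simps)
    also have "\<dots> = dot_on ?I w y - s * y 0"
      by (simp only: sum_subtractf m0 dot_on_def)
    finally show ?thesis .
  qed
  have comm: "dot_on ?I x y = dot_on ?I y x" for x y by (simp add: dot_on_def mult.commute)
  have vw: "dot_on ?I v w = c - s * w 0" by (simp add: vy c)
  have vv: "dot_on ?I v v = 2 * (c - s * w 0)"
    using vy[of v] comm[of w v] vw by (simp add: v_def s2 algebra_simps)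
  have vv0: "dot_on ?I v v \<noteq> 0" using vv sw c by auto
  let ?R = "reflect m v"
  have Rw: "mapply ?I ?R w i = (if i = 0 then s else 0)" if "i < m" for i
  proof -
    have "2 / dot_on ?I v v * dot_on ?I v w = 1" using vv0 unfolding vv vw by simp
    then show ?thesis using mapply_reflect[OF that, of v w] by (auto simp: v_def)
  qed
  have R0: "s * mapply ?I ?R y 0 = dot_on ?I w y" for y
  proof -
    have "dot_on ?I w y = dot_on ?I (mapply ?I ?R w) (mapply ?I ?R y)"
      by (simp add: dot_reflect[OF vv0])
    also have "\<dots> = (\<Sum>i<m. if i = 0 then s * mapply ?I ?R y i else 0)"
      unfolding dot_on_def by (rule sum.cong) (auto simp: Rw)
    also have "\<dots> = s * mapply ?I ?R y 0" by (rule m0)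
    finally show ?thesis by simp
  qed
  \<comment> \<open>For \<open>z\<close> the reflected \<open>L x\<close>, the target form is
    \<open>1 - b\<close> times the squared length of \<open>z\<close> plus \<open>b * c\<close>
    times the square of \<open>z 0\<close>. This is diagonal, and \<open>D\<close> holds the roots
    of its entries.\<close>
  define D where "D i = (if i = 0 then sqrt (1 - b + b * c) else sqrt (1 - b))" for i :: nat
  have D2: "D i * D i = (1 - b) + (if i = 0 then b * c else 0)" for i
    using b c by (auto simp: D_def)
  define RL where "RL i j = (\<Sum>k<m. ?R i k * L k j)" for i j
  define L' where "L' i j = (\<Sum>k<m. (if i = k then D i else 0) * RL k j)" for i j
  have L'x: "mapply ?I L' x i = D i * mapply ?I ?R (mapply ?I L x) i" if "i < m" for x i
  proof -
    have "mapply ?I L' x i = mapply ?I (\<lambda>i k. if i = k then D i else 0) (mapply ?I RL x) i"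
      unfolding L'_def by (rule mapply_mult)
    also have "\<dots> = D i * mapply ?I RL x i"
      unfolding mapply_def[of _ "\<lambda>i k. if i = k then D i else 0"]
      using that by (simp add: if_distrib[of "\<lambda>x. x * _"] cong: if_cong)
    also have "mapply ?I RL x i = mapply ?I ?R (mapply ?I L x) i"
      unfolding RL_def by (rule mapply_mult)
    finally show ?thesis .
  qed
  have uLw: "dot_on ?I w (mapply ?I L x) = dot_on ?I u x" for x
  proof -
    have "dot_on ?I w (mapply ?I L x) = (\<Sum>k<m. \<Sum>j<m. w k * L k j * x j)"
      by (simp add: dot_on_def mapply_def sum_distrib_left mult.assoc)
    also have "\<dots> = (\<Sum>j<m. \<Sum>k<m. w k * L k j * x j)" by (rule sum.swap)
    also have "\<dots> = dot_on ?I u x"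
      unfolding dot_on_def by (rule sum.cong) (auto simp: w sum_distrib_right)
    finally show ?thesis .
  qed
  have q: "dot_on ?I (mapply ?I L' x) (mapply ?I L' x)
         = (1 - b) * dot_on ?I (mapply ?I L x) (mapply ?I L x) + b * (dot_on ?I u x)\<^sup>2" for x
  proof -
    let ?y = "mapply ?I L x"
    let ?z = "mapply ?I ?R ?y"
    have "dot_on ?I (mapply ?I L' x) (mapply ?I L' x) = (\<Sum>i<m. D i * D i * (?z i * ?z i))"
      unfolding dot_on_def by (rule sum.cong) (auto simp: L'x)
    also have "\<dots> = (\<Sum>i<m. (1 - b) * (?z i * ?z i) + (if i = 0 then b * c * (?z i * ?z i) else 0))"
      by (rule sum.cong) (auto simp: D2 algebra_simps)
    also have "\<dots> = (1 - b) * dot_on ?I ?z ?z + b * c * (?z 0 * ?z 0)"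
      by (simp only: sum.distrib m0 sum_distrib_left[symmetric] dot_on_def)
    also have "c * (?z 0 * ?z 0) = (s * ?z 0)\<^sup>2"
      by (simp add: s2[symmetric] power2_eq_square)
    then have "b * c * (?z 0 * ?z 0) = b * (dot_on ?I u x)\<^sup>2"
      using R0[of ?y] uLw[of x] by simp
    finally show ?thesis by (simp add: dot_reflect[OF vv0])
  qed
  have "idx_det m L' = idx_det m (\<lambda>i j. if i = j then D i else 0) * idx_det m RL"
    unfolding L'_def by (rule idx_det_mult)
  also have "idx_det m RL = idx_det m ?R * idx_det m L"
    unfolding RL_def by (rule idx_det_mult)
  finally have "(idx_det m L')\<^sup>2 = (\<Prod>i<m. D i)\<^sup>2 * (idx_det m L)\<^sup>2"
    by (simp add: idx_det_diag power_mult_distrib idx_det_reflect_sq[OF vv0])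
  also have "(\<Prod>i<m. D i)\<^sup>2 = (\<Prod>i<m. D i * D i)"
    by (simp add: power2_eq_square prod.distrib)
  also have "\<dots> = (1 - b) ^ (m - 1) * (1 - b + b * c)"
  proof -
    \<comment> \<open>Splitting off coordinate 0 leaves \<open>m - 1\<close> equal factors
      \<open>1 - b\<close>.\<close>
    obtain k where k: "m = Suc k" using m gr0_implies_Suc by blast
    show ?thesis unfolding k prod.lessThan_Suc_shift by (simp add: D2)
  qed
  finally show ?thesis using q by blast
qed

text \<open>To first order in \<open>b\<close> the product is \<open>1 + b * (c - m)\<close>, a gain
  once \<open>c\<close> exceeds \<open>m\<close>. Bernoulli's inequality makes this uniform in
  \<open>c\<close>.\<close>

lemma rank_one_gain:
  fixes \<epsilon> :: real
  assumes "\<epsilon> > 0" "m > (0::nat)"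
  shows "\<exists>b \<eta>. 0 < b \<and> b < 1 \<and> 0 < \<eta> \<and>
    (\<forall>c \<ge> real m + \<epsilon>. (1 - b) ^ (m - 1) * (1 - b + b * c) \<ge> 1 + \<eta>)"
proof -
  define n where "n = real m - 1"
  have n: "n \<ge> 0" using assms by (simp add: n_def)
  \<comment> \<open>\<open>q\<close> dominates \<open>n * (n + \<epsilon>)\<close>, so with
    \<open>b = \<epsilon> / (2 * q)\<close> the quadratic loss is at most half of the linear gain
    \<open>\<epsilon> * b\<close>; and \<open>q > \<epsilon>\<close> gives
    \<open>b < 1\<close>.\<close>
  define q where "q = n * (n + \<epsilon>) + \<epsilon> + 1"
  have q: "q > 0" "q > \<epsilon>" using n assms by (auto simp: q_def add_nonneg_pos)
  define b where "b = \<epsilon> / (2 * q)"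
  have b: "0 < b" "b < 1" using q assms by (auto simp: b_def field_simps)
  define \<eta> where "\<eta> = \<epsilon> * b - n * (n + \<epsilon>) * b\<^sup>2"
  have "n * (n + \<epsilon>) * b \<le> q * b" using b assms by (intro mult_right_mono) (auto simp: q_def)
  also have "\<dots> = \<epsilon> / 2" using q by (simp add: b_def)
  finally have "b * (\<epsilon> - n * (n + \<epsilon>) * b) > 0" using b assms by (intro mult_pos_pos) auto
  then have \<eta>: "\<eta> > 0" by (simp add: \<eta>_def algebra_simps power2_eq_square)
  have "(1 - b) ^ (m - 1) * (1 - b + b * c) \<ge> 1 + \<eta>" if "c \<ge> real m + \<epsilon>" for c
  proof -
    have bern: "(1 - b) ^ (m - 1) \<ge> 1 - n * b"
      using Bernoulli_inequality[of "-b" "m - 1"] b assms by (simp add: n_def of_nat_diff)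
    have "b * c \<ge> b * (n + 1 + \<epsilon>)" using that b by (simp add: n_def)
    then have c: "1 - b + b * c \<ge> 1 + b * (n + \<epsilon>)" by (simp add: algebra_simps)
    have "1 + \<eta> = (1 - n * b) * (1 + b * (n + \<epsilon>))"
      by (simp add: \<eta>_def algebra_simps power2_eq_square)
    also have "\<dots> \<le> (1 - b) ^ (m - 1) * (1 + b * (n + \<epsilon>))"
      using bern b n assms by (intro mult_right_mono) auto
    also have "\<dots> \<le> (1 - b) ^ (m - 1) * (1 - b + b * c)"
      using c b by (intro mult_left_mono) auto
    finally show ?thesis .
  qed
  with b \<eta> show ?thesis by blast
qed

section \<open>Near-maximal determinant and the approximate John theorem\<close>

lemma dot_on_Cauchy_Schwarz:
  "(dot_on I x y)\<^sup>2 \<le> dot_on I x x * dot_on I y y"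
  unfolding dot_on_def using Cauchy_Schwarz_ineq_sum[of x y I] by (simp add: power2_eq_square)

lemma dot_on_self_nonneg: "dot_on I x x \<ge> 0"
  by (simp add: dot_on_def sum_nonneg)

text \<open>If some \<^term>\<open>u \<in> U\<close> violated the upper bound, mixing its square into the form would increase the
  determinant by a factor bounded away from 1, contradicting near-maximality.\<close>

lemma near_John_frame:
  assumes m: "m > 0" and eps: "\<epsilon> > 0" and \<delta>: "\<delta> > 0"
    and bd: "\<And>u i. u \<in> U \<Longrightarrow> i < m \<Longrightarrow> \<bar>u i\<bar> \<le> K"
    and span: "\<And>x s. (\<And>u. u \<in> U \<Longrightarrow> (dot_on {..<m} u x)\<^sup>2 \<le> s) \<Longrightarrow> \<delta> * dot_on {..<m} x x \<le> s"
  shows "\<exists>L. (\<forall>x s. (\<forall>u\<in>U. (dot_on {..<m} u x)\<^sup>2 \<le> s) \<longrightarrow>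
                 dot_on {..<m} (mapply {..<m} L x) (mapply {..<m} L x) \<le> s)
     \<and> (\<forall>x. \<forall>u\<in>U. (dot_on {..<m} u x)\<^sup>2 \<le>
                 (real m + \<epsilon>) * dot_on {..<m} (mapply {..<m} L x) (mapply {..<m} L x))"
proof -
  let ?I = "{..<m}"
  let ?n = "\<lambda>L x. dot_on ?I (mapply ?I L x) (mapply ?I L x)"
  \<comment> \<open>The competing forms lie below the supremum of the squared functionals;
    quantifying over all upper bounds \<open>s\<close> avoids mentioning that supremum.\<close>
  define F where "F = {L. \<forall>x s. (\<forall>u\<in>U. (dot_on ?I u x)\<^sup>2 \<le> s) \<longrightarrow> ?n L x \<le> s}"
  define X where "X = (\<lambda>L. (idx_det m L)\<^sup>2) ` F"
  obtain b \<eta> where b: "0 < b" "b < 1" and \<eta>: "\<eta> > 0"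
    and gain: "\<And>c. c \<ge> real m + \<epsilon> \<Longrightarrow> (1 - b) ^ (m - 1) * (1 - b + b * c) \<ge> 1 + \<eta>"
    using rank_one_gain[OF eps m] by blast
  have Lbd: "\<bar>L i j\<bar> \<le> \<bar>K\<bar>" if L: "L \<in> F" and i: "i < m" and j: "j < m" for L i j
  proof -
    \<comment> \<open>Testing at a basis vector bounds the squared length of column \<open>j\<close>
      of \<open>L\<close>.\<close>
    let ?e = "\<lambda>k. if k = j then 1 else (0::real)"
    have e: "dot_on ?I u ?e = u j" for u
      using j by (simp add: dot_on_def if_distrib[of "\<lambda>x. _ * x"] cong: if_cong)
    have Le: "mapply ?I L ?e i = L i j" for i
      using j by (simp add: mapply_def if_distrib[of "\<lambda>x. _ * x"] cong: if_cong)
    have "(u j)\<^sup>2 \<le> K\<^sup>2" if "u \<in> U" for u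
      using bd[OF that j] by (rule abs_le_square_iff[THEN iffD1, OF order_trans]) simp
    then have "?n L ?e \<le> K\<^sup>2" using L e unfolding F_def by auto
    moreover have "(L i j)\<^sup>2 \<le> ?n L ?e"
      unfolding dot_on_def Le power2_eq_square[symmetric] using i
      by (intro member_le_sum) auto
    ultimately have "(L i j)\<^sup>2 \<le> K\<^sup>2" by linarith
    then show ?thesis by (simp add: abs_le_square_iff)
  qed
  have bdd: "bdd_above X"
  proof (rule bdd_aboveI)
    fix y assume "y \<in> X"
    then obtain L where L: "L \<in> F" "y = (idx_det m L)\<^sup>2" by (auto simp: X_def)
    have "\<bar>idx_det m L\<bar> \<le> fact m * \<bar>K\<bar> ^ m" by (rule idx_det_bound) (rule Lbd[OF L(1)])
    then show "y \<le> (fact m * \<bar>K\<bar> ^ m)\<^sup>2"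
      unfolding L(2) by (rule abs_le_square_iff[THEN iffD1, OF order_trans]) simp
  qed
  \<comment> \<open>A scaled identity is admissible by \<open>span\<close>. It makes
    \<open>Sup X\<close> positive, so a near-maximal frame is invertible.\<close>
  define L0 where "L0 i j = (if i = j then sqrt \<delta> else (0::real))" for i j :: nat
  have L0x: "mapply ?I L0 x i = sqrt \<delta> * x i" if "i < m" for x i
    using that by (simp add: mapply_def L0_def if_distrib[of "\<lambda>x. x * _"] cong: if_cong)
  have "?n L0 x = \<delta> * dot_on ?I x x" for x
    unfolding dot_on_def sum_distrib_left using \<delta> by (intro sum.cong) (auto simp: L0x algebra_simps)
  then have L0F: "L0 \<in> F" unfolding F_def using span by simp
  have "idx_det m L0 = sqrt \<delta> ^ m" unfolding L0_def idx_det_diag by simp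
  then have det0: "(idx_det m L0)\<^sup>2 > 0" using \<delta> by simp
  have "(idx_det m L0)\<^sup>2 \<in> X" using L0F by (simp add: X_def)
  then have "Sup X > 0" using det0 cSup_upper[OF _ bdd, of "(idx_det m L0)\<^sup>2"] by linarith
  then have "Sup X / (1 + \<eta>) < Sup X" using \<eta> by (simp add: field_simps)
  then obtain L where L: "L \<in> F" and dL: "Sup X / (1 + \<eta>) < (idx_det m L)\<^sup>2"
    using L0F by (subst (asm) less_cSup_iff[OF _ bdd]) (auto simp: X_def)
  then have dL1: "Sup X < (1 + \<eta>) * (idx_det m L)\<^sup>2" using \<eta> by (simp add: field_simps)
  have dL0: "idx_det m L \<noteq> 0" using dL1 \<open>Sup X > 0\<close> by auto
  have "(dot_on ?I u x)\<^sup>2 \<le> (real m + \<epsilon>) * ?n L x" if u: "u \<in> U" for u x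
  proof -
    \<comment> \<open>As \<open>u\<close> pairs with \<open>x\<close> like \<open>w\<close> with
      \<open>L x\<close>, Cauchy-Schwarz reduces the claim to a bound on the squared length of
      \<open>w\<close>.\<close>
    obtain w where w: "\<And>j. j < m \<Longrightarrow> u j = (\<Sum>k<m. w k * L k j)"
      using idx_det_nonzero_solve[OF dL0] by blast
    let ?c = "dot_on ?I w w"
    have c: "?c \<le> real m + \<epsilon>"
    proof (rule ccontr)
      assume "\<not> ?thesis"
      then have cm: "?c \<ge> real m + \<epsilon>" by simp
      then have c0: "?c > 0" using m eps by linarith
      obtain L' where q: "\<And>x. ?n L' x = (1 - b) * ?n L x + b * (dot_on ?I u x)\<^sup>2"
        and d': "(idx_det m L')\<^sup>2 = (1 - b) ^ (m - 1) * (1 - b + b * ?c) * (idx_det m L)\<^sup>2"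
        using frame_rank_one_update[of m b u w L, OF m b w refl c0] by blast
      have "?n L' x \<le> s" if "\<forall>u\<in>U. (dot_on ?I u x)\<^sup>2 \<le> s" for x s
      proof -
        have "?n L x \<le> s" using L that by (auto simp: F_def)
        moreover have "(dot_on ?I u x)\<^sup>2 \<le> s" using that u by auto
        ultimately have "?n L' x \<le> (1 - b) * s + b * s"
          unfolding q using b by (intro add_mono mult_left_mono) auto
        then show ?thesis by (simp add: algebra_simps)
      qed
      then have "L' \<in> F" by (simp add: F_def)
      then have "(idx_det m L')\<^sup>2 \<le> Sup X" by (intro cSup_upper bdd) (simp add: X_def)
      moreover have "(1 + \<eta>) * (idx_det m L)\<^sup>2 \<le> (idx_det m L')\<^sup>2"
        unfolding d' by (intro mult_right_mono gain[OF cm]) simp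
      ultimately show False using dL1 by linarith
    qed
    have "dot_on ?I u x = (\<Sum>j<m. \<Sum>k<m. w k * L k j * x j)"
      unfolding dot_on_def by (rule sum.cong) (auto simp: w sum_distrib_right)
    also have "\<dots> = (\<Sum>k<m. \<Sum>j<m. w k * L k j * x j)" by (rule sum.swap)
    also have "\<dots> = dot_on ?I w (mapply ?I L x)"
      by (simp add: dot_on_def mapply_def sum_distrib_left mult.assoc)
    finally have "(dot_on ?I u x)\<^sup>2 \<le> ?c * ?n L x" by (simp add: dot_on_Cauchy_Schwarz)
    also have "\<dots> \<le> (real m + \<epsilon>) * ?n L x" by (intro mult_right_mono c dot_on_self_nonneg)
    finally show ?thesis .
  qed
  then show ?thesis using L by (intro exI[of _ L]) (auto simp: F_def)
qed

text \<open>The frame is transported along a bijection of \<open>I\<close> with an initial segment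
  of \<open>nat\<close>, and \<open>Q\<close> is its Gram form. Where \<open>Q\<close> vanishes the
  upper bound kills all functionals, so \<open>span\<close> yields definiteness.\<close>

lemma near_John_ellipsoid:
  fixes I :: "'i set" and U :: "('i \<Rightarrow> real) set"
  assumes fin: "finite I" and ne: "I \<noteq> {}" and eps: "\<epsilon> > 0" and \<delta>: "\<delta> > 0"
    and bd: "\<And>u i. u \<in> U \<Longrightarrow> i \<in> I \<Longrightarrow> \<bar>u i\<bar> \<le> K"
    and span: "\<And>x s. (\<And>u. u \<in> U \<Longrightarrow> (dot_on I u x)\<^sup>2 \<le> s) \<Longrightarrow> \<delta> * dot_on I x x \<le> s"
  shows "\<exists>Q. sym_on I Q \<and> posdef_on I Q
     \<and> (\<forall>x s. (\<forall>u\<in>U. (dot_on I u x)\<^sup>2 \<le> s) \<longrightarrow> qform I Q x \<le> s)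
     \<and> (\<forall>x. \<forall>u\<in>U. (dot_on I u x)\<^sup>2 \<le> (real (card I) + \<epsilon>) * qform I Q x)"
proof -
  let ?m = "card I"
  let ?J = "{..<?m}"
  obtain h where h: "bij_betw h ?J I"
    using ex_bij_betw_nat_finite[OF fin] by (auto simp: atLeast0LessThan)
  define g where "g = inv_into ?J h"
  have g: "bij_betw g I ?J" unfolding g_def by (rule bij_betw_inv_into[OF h])
  have gh: "g (h j) = j" if "j < ?m" for j
    unfolding g_def using that by (intro inv_into_f_f bij_betw_imp_inj_on[OF h]) simp
  have hg: "h (g i) = i" if "i \<in> I" for i
    unfolding g_def using that h by (intro f_inv_into_f) (simp add: bij_betw_def)
  have sumI: "(\<Sum>i\<in>I. f i) = (\<Sum>j<?m. f (h j))" for f :: "'i \<Rightarrow> real"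
    using sum.reindex_bij_betw[OF h, of f] by simp
  have dot: "dot_on I x y = dot_on ?J (x \<circ> h) (y \<circ> h)" for x y
    by (simp add: dot_on_def sumI)
  have m: "?m > 0" using fin ne by (simp add: card_gt_0_iff)
  let ?U = "(\<lambda>u. u \<circ> h) ` U"
  have "\<exists>L. (\<forall>x s. (\<forall>u\<in>?U. (dot_on ?J u x)\<^sup>2 \<le> s) \<longrightarrow>
                 dot_on ?J (mapply ?J L x) (mapply ?J L x) \<le> s)
     \<and> (\<forall>x. \<forall>u\<in>?U. (dot_on ?J u x)\<^sup>2 \<le>
                 (real ?m + \<epsilon>) * dot_on ?J (mapply ?J L x) (mapply ?J L x))"
  proof (rule near_John_frame[OF m eps \<delta>])
    fix u i assume "u \<in> ?U" "i < ?m"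
    then show "\<bar>u i\<bar> \<le> K" using bd bij_betwE[OF h] by auto
  next
    fix x s assume *: "\<And>u. u \<in> ?U \<Longrightarrow> (dot_on ?J u x)\<^sup>2 \<le> s"
    have x: "dot_on ?J u ((x \<circ> g) \<circ> h) = dot_on ?J u x" for u
      unfolding dot_on_def by (rule sum.cong) (auto simp: gh)
    have "\<delta> * dot_on I (x \<circ> g) (x \<circ> g) \<le> s"
    proof (rule span)
      fix u assume "u \<in> U"
      then show "(dot_on I u (x \<circ> g))\<^sup>2 \<le> s" unfolding dot x by (intro *) simp
    qed
    then show "\<delta> * dot_on ?J x x \<le> s"
      unfolding dot x by (simp add: dot_on_def gh)
  qed
  then obtain L where
    L1: "\<And>x s. (\<And>u. u \<in> U \<Longrightarrow> (dot_on ?J (u \<circ> h) x)\<^sup>2 \<le> s) \<Longrightarrow>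
                 dot_on ?J (mapply ?J L x) (mapply ?J L x) \<le> s"
    and L2: "\<And>x u. u \<in> U \<Longrightarrow> (dot_on ?J (u \<circ> h) x)\<^sup>2 \<le>
                 (real ?m + \<epsilon>) * dot_on ?J (mapply ?J L x) (mapply ?J L x)"
    by fastforce
  define Q where "Q i j = (\<Sum>k<?m. L k (g i) * L k (g j))" for i j
  have q: "qform I Q x = dot_on ?J (mapply ?J L (x \<circ> h)) (mapply ?J L (x \<circ> h))" for x
  proof -
    have "qform I Q x = (\<Sum>i<?m. \<Sum>j<?m. \<Sum>k<?m. (L k i * x (h i)) * (L k j * x (h j)))"
      unfolding qform_def sumI Q_def
      by (intro sum.cong refl)
        (auto simp: sum_distrib_left sum_distrib_right gh algebra_simps intro!: sum.cong)
    also have "\<dots> = (\<Sum>i<?m. \<Sum>k<?m. \<Sum>j<?m. (L k i * x (h i)) * (L k j * x (h j)))"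
      by (intro sum.cong refl sum.swap)
    also have "\<dots> = (\<Sum>k<?m. \<Sum>i<?m. \<Sum>j<?m. (L k i * x (h i)) * (L k j * x (h j)))"
      by (rule sum.swap)
    also have "\<dots> = dot_on ?J (mapply ?J L (x \<circ> h)) (mapply ?J L (x \<circ> h))"
      by (simp add: dot_on_def mapply_def sum_product)
    finally show ?thesis .
  qed
  have upper: "(dot_on I u x)\<^sup>2 \<le> (real (card I) + \<epsilon>) * qform I Q x" if "u \<in> U" for u x
    using L2[OF that] by (simp add: q dot)
  have lower: "qform I Q x \<le> s" if "\<forall>u\<in>U. (dot_on I u x)\<^sup>2 \<le> s" for x s
    unfolding q using that by (intro L1) (simp add: dot)
  have "qform I Q x > 0" if x: "\<exists>i\<in>I. x i \<noteq> 0" for x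
  proof (rule ccontr)
    assume "\<not> ?thesis"
    then have q0: "qform I Q x = 0" using dot_on_self_nonneg by (metis q less_eq_real_def)
    have "\<delta> * dot_on I x x \<le> 0"
      using upper[of _ x] q0 by (intro span) simp
    then have "dot_on I x x \<le> 0" using \<delta> by (simp add: mult_le_0_iff)
    then have "dot_on I x x = 0" using dot_on_self_nonneg[of I x] by simp
    then show False using x fin by (auto simp: dot_on_def sum_nonneg_eq_0_iff)
  qed
  then have "posdef_on I Q" by (simp add: posdef_on_def)
  moreover have "sym_on I Q" by (simp add: sym_on_def Q_def mult.commute)
  ultimately show ?thesis using upper lower by blast
qed

section \<open>Lyapunov functions on the lifted space\<close>

lemma norm_vector_matrix_le:
  fixes M :: "real^'n^'n"
  shows "norm (z v* M) \<le> onorm ((*v) M) * norm z"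
proof -
  let ?y = "z v* M"
  have bl: "bounded_linear ((*v) M)" by simp
  have "norm ?y * norm ?y = ?y \<bullet> ?y" by (simp add: dot_square_norm power2_eq_square)
  also have "\<dots> = z \<bullet> (M *v ?y)" by (rule dot_lmul_matrix)
  also have "\<dots> \<le> norm z * norm (M *v ?y)" by (rule norm_cauchy_schwarz)
  also have "\<dots> \<le> norm z * (onorm ((*v) M) * norm ?y)"
    by (intro mult_left_mono onorm[OF bl]) simp
  finally have "norm ?y * norm ?y \<le> (onorm ((*v) M) * norm z) * norm ?y" by (simp add: mult_ac)
  then show ?thesis
    by (cases "norm ?y = 0") (auto simp: onorm_pos_le[OF bl])
qed

text \<open>The scaled adjoint trajectories ending in the ball of radius \<^term>\<open>c\<close>; read along a path from
  \<^term>\<open>v\<close>, they are the functionals whose squares bound the Lyapunov function at \<^term>\<open>v\<close>.\<close>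

inductive adj_orbit ::
  "('v \<times> 'v \<times> 'l) set \<Rightarrow> ('l \<Rightarrow> real^'n^'n) \<Rightarrow> real \<Rightarrow> real \<Rightarrow> 'v \<Rightarrow> real^'n \<Rightarrow> bool"
  for E A r c where
  base: "norm z \<le> c \<Longrightarrow> adj_orbit E A r c v z"
| step: "(v, w, s) \<in> E \<Longrightarrow> adj_orbit E A r c w y \<Longrightarrow> adj_orbit E A r c v ((1 / r) *\<^sub>R (y v* A s))"

text \<open>A step of the orbit prepends an edge to the path, so its matrix enters the product on
  the right; hence the shift by \<open>case_nat\<close>.\<close>

lemma adj_orbit_path:
  fixes A :: "'l \<Rightarrow> real^'n^'n"
  assumes "adj_orbit E A r c v y"
  shows "\<exists>t \<sigma> p z. p 0 = v \<and> (\<forall>k<t. (p k, p (Suc k), \<sigma> k) \<in> E) \<and> norm z \<le> c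
           \<and> y = (1 / r) ^ t *\<^sub>R (z v* mprod A \<sigma> t)"
  using assms
proof induction
  case (base z v)
  show ?case
    by (rule exI[of _ 0], rule exI[of _ undefined], rule exI[of _ "\<lambda>_. v"], rule exI[of _ z])
      (use base in simp)
next
  case (step v w s y)
  then obtain t \<sigma> p z where p: "p 0 = w" "\<forall>k<t. (p k, p (Suc k), \<sigma> k) \<in> E"
    and z: "norm z \<le> c" and y: "y = (1 / r) ^ t *\<^sub>R (z v* mprod A \<sigma> t)" by blast
  let ?p = "case_nat v p" and ?\<sigma> = "case_nat s \<sigma>"
  have "(?p k, ?p (Suc k), ?\<sigma> k) \<in> E" if "k < Suc t" for k
    using that p step.hyps by (cases k) auto
  moreover have "(1 / r) *\<^sub>R (y v* A s) = (1 / r) ^ Suc t *\<^sub>R (z v* mprod A ?\<sigma> (Suc t))"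
    unfolding mprod_Suc_shift y by (simp add: vector_matrix_mul_assoc scaleR_vector_matrix_assoc)
  ultimately show ?case
    using z by - (rule exI[of _ "Suc t"], rule exI[of _ ?\<sigma>], rule exI[of _ ?p], rule exI[of _ z], simp)
qed

text \<open>The scaling by powers of \<open>1 / r\<close> cancels the growth
  \<open>K * r ^ t\<close>, uniformly in the node and in the length of the path.\<close>

lemma adj_orbit_bounded:
  fixes A :: "'l \<Rightarrow> real^'n^'n"
  assumes aut: "automaton V E" and r: "cjsr E A < r" and c: "c \<ge> 0"
  shows "\<exists>K. \<forall>v y. adj_orbit E A r c v y \<longrightarrow> norm y \<le> K"
proof -
  have r0: "r > 0" using cjsr_nonneg[OF aut, of A] r by linarith
  have fin: "finite E" using aut by (simp add: automaton_def)
  obtain K where K: "K > 0" "\<And>t. max_growth E A t \<le> K * r ^ t"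
    using max_growth_bound[OF aut r] by blast
  have "norm y \<le> K * c" if orb: "adj_orbit E A r c v y" for v y
  proof -
    obtain t \<sigma> p z where p: "\<forall>k<t. (p k, p (Suc k), \<sigma> k) \<in> E"
      and z: "norm z \<le> c" and y: "y = (1 / r) ^ t *\<^sub>R (z v* mprod A \<sigma> t)"
      using adj_orbit_path[OF orb] by blast
    have acc: "accepted E t \<sigma>" unfolding accepted_def using p by blast
    have "norm (z v* mprod A \<sigma> t) \<le> onorm ((*v) (mprod A \<sigma> t)) * norm z"
      by (rule norm_vector_matrix_le)
    also have "\<dots> \<le> (K * r ^ t) * c"
      using K r0 z order_trans[OF onorm_le_max_growth[OF fin acc] K(2)]
      by (intro mult_mono) auto
    finally have "norm y \<le> (1 / r) ^ t * ((K * r ^ t) * c)"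
      unfolding y using r0 by (simp add: mult_left_mono)
    also have "\<dots> = K * c" using r0 by (simp add: power_one_over)
    finally show ?thesis .
  qed
  then show ?thesis by blast
qed

text \<open>Each node gets the near-John form of its orbit. Along an edge, the lower estimate is
  used at the target and the upper one at the source, so the dimension factor is paid once per
  inequality.\<close>

lemma lyap_feasible_above_cjsr:
  fixes V :: "'v set" and E :: "('v \<times> 'v \<times> 'l) set" and A :: "'l \<Rightarrow> real^'n^'n"
  assumes aut: "automaton V E" and r: "cjsr E A < r" and eps: "\<epsilon> > 0"
  shows "lyap_feasible (multi_idx d) V E (\<lambda>s. lift_mat d (A s))
     (r ^ d * sqrt (real (card (multi_idx d :: ('n \<Rightarrow> nat) set)) + \<epsilon>))"
proof -
  let ?I = "multi_idx d :: ('n \<Rightarrow> nat) set"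
  let ?m = "real (card ?I)"
  have r0: "r > 0" using cjsr_nonneg[OF aut, of A] r by linarith
  \<comment> \<open>A ball of this radius contains the unit cube, on which spanning was
    established.\<close>
  define c where "c = real CARD('n)"
  define U where "U v = lift_vec d ` {y. adj_orbit E A r c v y}" for v
  obtain K where K: "\<And>v y. adj_orbit E A r c v y \<Longrightarrow> norm y \<le> K"
    using adj_orbit_bounded[OF aut r, of c] by (auto simp: c_def)
  obtain \<delta> where \<delta>: "\<delta> > 0"
    and span: "\<And>x s. (\<And>z :: real^'n. (\<forall>i. \<bar>z $ i\<bar> \<le> 1) \<Longrightarrow> (dot_on ?I (lift_vec d z) x)\<^sup>2 \<le> s)
      \<Longrightarrow> \<delta> * dot_on ?I x x \<le> s"
    using lift_cube_spanning[where 'n = 'n and d = d] by blast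
  have cube: "adj_orbit E A r c v z" if "\<forall>i. \<bar>z $ i\<bar> \<le> 1" for v z
  proof (rule adj_orbit.base)
    have "norm z \<le> (\<Sum>i\<in>UNIV. \<bar>z $ i\<bar>)" by (rule norm_le_l1_cart)
    also have "\<dots> \<le> (\<Sum>i\<in>(UNIV :: 'n set). 1)" by (rule sum_mono) (use that in auto)
    finally show "norm z \<le> c" by (simp add: c_def)
  qed
  define R where "R v Q \<longleftrightarrow> sym_on ?I Q \<and> posdef_on ?I Q
     \<and> (\<forall>x s. (\<forall>u\<in>U v. (dot_on ?I u x)\<^sup>2 \<le> s) \<longrightarrow> qform ?I Q x \<le> s)
     \<and> (\<forall>x. \<forall>u\<in>U v. (dot_on ?I u x)\<^sup>2 \<le> (?m + \<epsilon>) * qform ?I Q x)" for v Q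
  have "\<exists>Q. R v Q" for v
    unfolding R_def
  proof (rule near_John_ellipsoid[OF finite_multi_idx multi_idx_nonempty eps \<delta>])
    fix u \<alpha> assume "u \<in> U v" and \<alpha>: "\<alpha> \<in> ?I"
    then obtain y where y: "u = lift_vec d y" "adj_orbit E A r c v y" by (auto simp: U_def)
    have "\<bar>u \<alpha>\<bar> \<le> norm y ^ d" unfolding y(1) by (rule lift_vec_bound[OF \<alpha>])
    also have "\<dots> \<le> K ^ d" by (rule power_mono[OF K[OF y(2)]]) simp
    finally show "\<bar>u \<alpha>\<bar> \<le> K ^ d" .
  next
    fix x s assume "\<And>u. u \<in> U v \<Longrightarrow> (dot_on ?I u x)\<^sup>2 \<le> s"
    then show "\<delta> * dot_on ?I x x \<le> s" by (intro span) (simp add: U_def cube)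
  qed
  then have "\<forall>v. \<exists>Q. R v Q" by blast
  then obtain Q where R: "\<forall>v. R v (Q v)" by (rule choice[THEN exE])
  have pd: "sym_on ?I (Q v)" "posdef_on ?I (Q v)" for v
    using R unfolding R_def by blast+
  have lower: "qform ?I (Q v) x \<le> s" if "\<forall>u\<in>U v. (dot_on ?I u x)\<^sup>2 \<le> s" for v x s
    using R that unfolding R_def by blast
  have upper: "(dot_on ?I u x)\<^sup>2 \<le> (?m + \<epsilon>) * qform ?I (Q v) x" if "u \<in> U v" for v x u
    using R that unfolding R_def by blast
  let ?g = "r ^ d * sqrt (?m + \<epsilon>)"
  have g2: "?g\<^sup>2 = (r ^ d)\<^sup>2 * (?m + \<epsilon>)" using eps by (simp add: power_mult_distrib)
  have "qform ?I (Q w) (mapply ?I (lift_mat d (A s)) x) \<le> ?g\<^sup>2 * qform ?I (Q v) x"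
    if e: "(v, w, s) \<in> E" for v w s x
  proof (rule lower, rule ballI)
    fix u assume "u \<in> U w"
    then obtain y where y: "u = lift_vec d y" "adj_orbit E A r c w y" by (auto simp: U_def)
    let ?y = "(1 / r) *\<^sub>R (y v* A s)"
    have "dot_on ?I u (mapply ?I (lift_mat d (A s)) x) = dot_on ?I (lift_vec d (y v* A s)) x"
      unfolding y(1) by (rule dot_lift_mat)
    \<comment> \<open>Rescaling brings the pulled-back functional into the orbit at
      \<open>v\<close>; homogeneity of the lift turns \<open>r\<close> into
      \<open>r ^ d\<close>.\<close>
    also have "y v* A s = r *\<^sub>R ?y" using r0 by simp
    also have "dot_on ?I (lift_vec d (r *\<^sub>R ?y)) x = r ^ d * dot_on ?I (lift_vec d ?y) x"
      unfolding dot_on_def sum_distrib_left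
      by (rule sum.cong) (simp_all only: lift_vec_scaleR mult.assoc)
    finally have "(dot_on ?I u (mapply ?I (lift_mat d (A s)) x))\<^sup>2
        = (r ^ d)\<^sup>2 * (dot_on ?I (lift_vec d ?y) x)\<^sup>2" by (simp add: power_mult_distrib)
    also have "\<dots> \<le> (r ^ d)\<^sup>2 * ((?m + \<epsilon>) * qform ?I (Q v) x)"
      using adj_orbit.step[OF e y(2)] by (intro mult_left_mono upper) (auto simp: U_def)
    finally show "(dot_on ?I u (mapply ?I (lift_mat d (A s)) x))\<^sup>2 \<le> ?g\<^sup>2 * qform ?I (Q v) x"
      by (simp add: g2 mult.assoc)
  qed
  then show ?thesis unfolding lyap_feasible_def using pd by (intro exI[of _ Q]) auto
qed

section \<open>Lower bound: Lyapunov forms against norms\<close>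

lemma qform_cong:
  assumes "\<And>i. i \<in> I \<Longrightarrow> x i = y i"
  shows "qform I Q x = qform I Q y"
  unfolding qform_def by (intro sum.cong) (auto simp: assms)

text \<open>On the compact unit sphere the form is continuous and positive, since lifts of unit
  vectors are nonzero. Homogeneity of degree \<open>2 * d\<close> carries its extrema to all
  vectors.\<close>

lemma qform_lift_comparable:
  fixes Q :: "('n::finite \<Rightarrow> nat) \<Rightarrow> ('n \<Rightarrow> nat) \<Rightarrow> real"
  assumes "posdef_on (multi_idx d) Q" and d: "d \<ge> 1"
  shows "\<exists>a>0. \<exists>b>0. \<forall>z :: real^'n. a * norm z ^ (2 * d) \<le> qform (multi_idx d) Q (lift_vec d z)
      \<and> qform (multi_idx d) Q (lift_vec d z) \<le> b * norm z ^ (2 * d)"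
proof -
  let ?I = "multi_idx d :: ('n \<Rightarrow> nat) set"
  let ?g = "\<lambda>z :: real^'n. qform ?I Q (lift_vec d z)"
  have cont: "continuous_on (sphere 0 1) ?g"
    unfolding qform_def lift_vec_def by (intro continuous_intros)
  have ne: "sphere (0 :: real^'n) 1 \<noteq> {}" by simp
  have pos: "?g z > 0" if "norm z = 1" for z
  proof -
    have "dot_on ?I (lift_vec d z) (lift_vec d z) = 1"
      using that by (simp add: dot_lift_vec dot_square_norm)
    then have "\<exists>\<alpha>\<in>?I. lift_vec d z \<alpha> \<noteq> 0"
      by (rule contrapos_pp) (simp add: dot_on_def)
    then show ?thesis using assms by (simp add: posdef_on_def)
  qed
  have hom: "?g z = norm z ^ (2 * d) * ?g (z /\<^sub>R norm z)" if "z \<noteq> 0" for z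
  proof -
    let ?u = "z /\<^sub>R norm z"
    have "?g z = qform ?I Q (\<lambda>\<alpha>. norm z ^ d * lift_vec d ?u \<alpha>)"
    proof (rule qform_cong)
      fix \<alpha> assume "\<alpha> \<in> ?I"
      then show "lift_vec d z \<alpha> = norm z ^ d * lift_vec d ?u \<alpha>"
        using lift_vec_scaleR[of \<alpha> d "norm z" ?u] that by simp
    qed
    also have "\<dots> = norm z ^ (2 * d) * ?g ?u"
      unfolding qform_def sum_distrib_left mult_2 power_add by (intro sum.cong) (auto simp: mult_ac)
    finally show ?thesis .
  qed
  obtain z0 where z0: "norm z0 = 1" "\<And>z. norm z = 1 \<Longrightarrow> ?g z0 \<le> ?g z"
    using continuous_attains_inf[OF compact_sphere ne cont] by auto
  obtain z1 where z1: "norm z1 = 1" "\<And>z. norm z = 1 \<Longrightarrow> ?g z \<le> ?g z1"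
    using continuous_attains_sup[OF compact_sphere ne cont] by auto
  have "?g z0 * norm z ^ (2 * d) \<le> ?g z \<and> ?g z \<le> ?g z1 * norm z ^ (2 * d)" if "z \<noteq> 0" for z
    unfolding hom[OF that] using that z0(2)[of "z /\<^sub>R norm z"] z1(2)[of "z /\<^sub>R norm z"]
    by (auto simp: mult.commute mult_left_mono)
  moreover have "?g z0 * norm z ^ (2 * d) \<le> ?g z \<and> ?g z \<le> ?g z1 * norm z ^ (2 * d)" if "z = 0" for z
  proof -
    have "lift_vec d z \<alpha> = 0" if "\<alpha> \<in> ?I" for \<alpha>
      using lift_vec_scaleR[OF that, of 0 0] \<open>z = 0\<close> d by (simp add: power_0_left)
    then have "?g z = 0" by (simp add: qform_def)
    then show ?thesis using d \<open>z = 0\<close> by (simp add: power_0_left)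
  qed
  ultimately show ?thesis using pos[OF z0(1)] pos[OF z1(1)] by blast
qed

lemma lyap_feasible_path_bound:
  fixes A :: "'l \<Rightarrow> real^'n^'n"
  assumes Q: "\<And>v w s x. (v, w, s) \<in> E \<Longrightarrow>
      qform (multi_idx d) (Q w) (mapply (multi_idx d) (lift_mat d (A s)) x)
        \<le> \<gamma>\<^sup>2 * qform (multi_idx d) (Q v) x"
    and p: "\<And>k. k < t \<Longrightarrow> (p k, p (Suc k), \<sigma> k) \<in> E"
  shows "qform (multi_idx d) (Q (p t)) (lift_vec d (mprod A \<sigma> t *v x))
      \<le> (\<gamma>\<^sup>2) ^ t * qform (multi_idx d) (Q (p 0)) (lift_vec d x)"
  using p
proof (induction t)
  case 0
  then show ?case by simp
next
  case (Suc t)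
  let ?I = "multi_idx d :: ('n \<Rightarrow> nat) set"
  let ?y = "mprod A \<sigma> t *v x"
  have "qform ?I (Q (p (Suc t))) (lift_vec d (mprod A \<sigma> (Suc t) *v x))
      = qform ?I (Q (p (Suc t))) (mapply ?I (lift_mat d (A (\<sigma> t))) (lift_vec d ?y))"
    by (rule qform_cong) (simp add: lift_mat_apply matrix_vector_mul_assoc)
  also have "\<dots> \<le> \<gamma>\<^sup>2 * qform ?I (Q (p t)) (lift_vec d ?y)"
    by (rule Q) (use Suc.prems in simp)
  also have "\<dots> \<le> \<gamma>\<^sup>2 * ((\<gamma>\<^sup>2) ^ t * qform ?I (Q (p 0)) (lift_vec d x))"
    using Suc by (intro mult_left_mono) auto
  finally show ?case by (simp add: mult.assoc)
qed

text \<open>Iterating the inequality along a path bounds the product by \<open>K * g ^ t\<close>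
  with \<open>g ^ d = \<gamma>\<close>; the comparison constants at the two ends of the path enter
  only \<open>K\<close>.\<close>

lemma cjsr_le_of_lyap_feasible:
  fixes V :: "'v set" and E :: "('v \<times> 'v \<times> 'l) set" and A :: "'l \<Rightarrow> real^'n^'n"
  assumes aut: "automaton V E" and d: "d \<ge> 1" and \<gamma>: "\<gamma> \<ge> 0"
    and feas: "lyap_feasible (multi_idx d) V E (\<lambda>s. lift_mat d (A s)) \<gamma>"
  shows "cjsr E A \<le> \<gamma> powr (1 / real d)"
proof -
  let ?I = "multi_idx d :: ('n \<Rightarrow> nat) set"
  obtain Q where pd: "\<And>v. v \<in> V \<Longrightarrow> posdef_on ?I (Q v)"
    and Q: "\<And>v w s x. (v, w, s) \<in> E \<Longrightarrow>
      qform ?I (Q w) (mapply ?I (lift_mat d (A s)) x) \<le> \<gamma>\<^sup>2 * qform ?I (Q v) x"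
  proof -
    from feas obtain Q where "\<forall>v\<in>V. sym_on ?I (Q v) \<and> posdef_on ?I (Q v)"
      and Q: "\<forall>(v, w, s)\<in>E. \<forall>x. \<gamma>\<^sup>2 * qform ?I (Q v) x
        - qform ?I (Q w) (mapply ?I (lift_mat d (A s)) x) \<ge> 0"
      unfolding lyap_feasible_def by blast
    then show ?thesis
      by (intro that[of Q]) (blast, use Q in \<open>blast dest: iffD1[OF diff_ge_0_iff_ge]\<close>)
  qed
  have fin: "finite V" and EV: "E \<subseteq> V \<times> V \<times> UNIV" and Vne: "V \<noteq> {}"
    using aut by (auto simp: automaton_def)
  have "\<forall>v\<in>V. \<exists>ab. fst ab > 0 \<and> snd ab > 0 \<and> (\<forall>z :: real^'n.
      fst ab * norm z ^ (2 * d) \<le> qform ?I (Q v) (lift_vec d z)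
      \<and> qform ?I (Q v) (lift_vec d z) \<le> snd ab * norm z ^ (2 * d))"
  proof
    fix v assume "v \<in> V"
    then obtain a b where "a > 0" "b > 0" "\<forall>z :: real^'n. a * norm z ^ (2 * d) \<le> qform ?I (Q v) (lift_vec d z)
      \<and> qform ?I (Q v) (lift_vec d z) \<le> b * norm z ^ (2 * d)"
      using qform_lift_comparable[OF pd d] by blast
    then show "\<exists>ab. fst ab > 0 \<and> snd ab > 0 \<and> (\<forall>z :: real^'n.
      fst ab * norm z ^ (2 * d) \<le> qform ?I (Q v) (lift_vec d z)
      \<and> qform ?I (Q v) (lift_vec d z) \<le> snd ab * norm z ^ (2 * d))"
      by (intro exI[of _ "(a, b)"]) simp
  qed
  then obtain ab where ab: "\<forall>v\<in>V. fst (ab v) > 0 \<and> snd (ab v) > 0 \<and> (\<forall>z :: real^'n.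
      fst (ab v) * norm z ^ (2 * d) \<le> qform ?I (Q v) (lift_vec d z)
      \<and> qform ?I (Q v) (lift_vec d z) \<le> snd (ab v) * norm z ^ (2 * d))"
    by (rule bchoice[THEN exE])
  define a b where "a v = fst (ab v)" and "b v = snd (ab v)" for v
  have a0: "a v > 0" and b0: "b v > 0" if "v \<in> V" for v
    using ab that by (auto simp: a_def b_def)
  have alo: "a v * norm z ^ (2 * d) \<le> qform ?I (Q v) (lift_vec d z)"
    and bhi: "qform ?I (Q v) (lift_vec d z) \<le> b v * norm z ^ (2 * d)" if "v \<in> V" for v and z :: "real^'n"
    using ab that by (auto simp: a_def b_def)
  \<comment> \<open>Sums of positive terms replace maxima; \<open>C\<close> bounds every ratio
    \<open>b v / a w\<close>.\<close>
  define C where "C = (\<Sum>v\<in>V. 1 / a v) * (\<Sum>v\<in>V. b v)"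
  have C: "C > 0" unfolding C_def using a0 b0 fin Vne by (intro mult_pos_pos sum_pos) auto
  have ba: "b v / a w \<le> C" if "v \<in> V" "w \<in> V" for v w
  proof -
    have "1 / a w \<le> (\<Sum>v\<in>V. 1 / a v)"
      using that fin a0 by (intro member_le_sum) (auto simp: less_imp_le)
    moreover have "b v \<le> (\<Sum>v\<in>V. b v)"
      using that fin b0 by (intro member_le_sum) (auto simp: less_imp_le)
    ultimately have "1 / a w * b v \<le> C"
      unfolding C_def using a0 b0 that
      by (intro mult_mono sum_nonneg) (auto simp: less_imp_le)
    then show ?thesis by simp
  qed
  define g where "g = \<gamma> powr (1 / real d)"
  define K where "K = C powr (1 / real (2 * d))"
  have gd: "g ^ d = \<gamma>" unfolding g_def using powr_inverse_power[OF \<gamma> d] .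
  have Kd: "K ^ (2 * d) = C" unfolding K_def using C d by (intro powr_inverse_power) auto
  have g0: "g \<ge> 0" and K0: "K > 0" using C by (auto simp: g_def K_def)
  have "cjsr E A \<le> g"
  proof (rule cjsr_le[OF aut g0 K0])
    fix t :: nat assume t: "t \<ge> 1"
    obtain \<sigma> where acc: "accepted E t \<sigma>" and mg: "max_growth E A t = onorm ((*v) (mprod A \<sigma> t))"
      by (rule max_growth_attained[OF aut])
    then obtain p where p: "\<And>k. k < t \<Longrightarrow> (p k, p (Suc k), \<sigma> k) \<in> E"
      by (auto simp: accepted_def)
    \<comment> \<open>Only edges constrain \<open>p\<close>, so \<open>t \<ge> 1\<close> is what
      places both ends in \<open>V\<close>.\<close>
    have p0: "p 0 \<in> V" using p[of 0] t EV by auto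
    have pt: "p t \<in> V" using p[of "t - 1"] t EV by auto
    have "norm (mprod A \<sigma> t *v x) \<le> K * g ^ t * norm x" for x
    proof -
      let ?y = "mprod A \<sigma> t *v x"
      have "a (p t) * norm ?y ^ (2 * d) \<le> qform ?I (Q (p t)) (lift_vec d ?y)" by (rule alo[OF pt])
      also have "\<dots> \<le> (\<gamma>\<^sup>2) ^ t * qform ?I (Q (p 0)) (lift_vec d x)"
        by (rule lyap_feasible_path_bound[where E = E and Q = Q]) (use Q p in auto)
      also have "\<dots> \<le> (\<gamma>\<^sup>2) ^ t * (b (p 0) * norm x ^ (2 * d))"
        by (intro mult_left_mono bhi[OF p0]) simp
      finally have "norm ?y ^ (2 * d) \<le> (\<gamma>\<^sup>2) ^ t * (b (p 0) / a (p t) * norm x ^ (2 * d))"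
        using a0[OF pt] by (simp add: field_simps)
      also have "\<dots> \<le> (\<gamma>\<^sup>2) ^ t * (C * norm x ^ (2 * d))"
        by (intro mult_left_mono mult_right_mono ba p0 pt) auto
      also have "\<dots> = (K * g ^ t * norm x) ^ (2 * d)"
      proof -
        have "(g ^ t) ^ (2 * d) = (\<gamma>\<^sup>2) ^ t"
          unfolding gd[symmetric] by (simp add: power_mult[symmetric] mult_ac)
        then show ?thesis by (simp add: power_mult_distrib Kd)
      qed
      finally show ?thesis
        by (subst (asm) power_mono_iff) (use d g0 K0 in auto)
    qed
    then show "max_growth E A t \<le> K * g ^ t"
      unfolding mg using g0 K0 by (intro onorm_bound) auto
  qed
  then show ?thesis by (simp add: g_def)
qed

section \<open>Passing to the infimum\<close>

theorem theorem3p6: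
  fixes V :: "'v set" and E :: "('v \<times> 'v \<times> 'l) set"
    and A :: "'l \<Rightarrow> real^'n^'n" and d :: nat
  assumes "automaton V E" and "d \<ge> 1"
  shows "cjsr E A \<le> gamma_star (multi_idx d) V E (\<lambda>s. lift_mat d (A s)) powr (1 / real d)
       \<and> gamma_star (multi_idx d) V E (\<lambda>s. lift_mat d (A s)) powr (1 / real d)
           \<le> real ((CARD('n) + d - 1) choose d) powr (1 / (2 * real d)) * cjsr E A"
proof -
  let ?I = "multi_idx d :: ('n \<Rightarrow> nat) set"
  let ?\<rho> = "cjsr E A" and ?m = "real (card ?I)"
  let ?G = "{\<gamma>. \<gamma> \<ge> 0 \<and> lyap_feasible ?I V E (\<lambda>s. lift_mat d (A s)) \<gamma>}"
  let ?\<gamma> = "gamma_star ?I V E (\<lambda>s. lift_mat d (A s))"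
  have \<rho>0: "?\<rho> \<ge> 0" by (rule cjsr_nonneg[OF assms(1)])
  \<comment> \<open>One \<open>e\<close> serves both as the margin above \<open>?\<rho>\<close> and
    as the slack in the dimension factor.\<close>
  have G: "(?\<rho> + e) ^ d * sqrt (?m + e) \<in> ?G" if "e > 0" for e
    using lyap_feasible_above_cjsr[OF assms(1), of A "?\<rho> + e" e d] that \<rho>0 by simp
  have "(?\<rho> + 1) ^ d * sqrt (?m + 1) \<in> ?G" by (rule G) simp
  then have Gne: "?G \<noteq> {}" by (metis empty_iff)
  have "?\<rho> ^ d \<le> ?\<gamma>" unfolding gamma_star_def
  proof (rule cInf_greatest[OF Gne])
    fix \<gamma> assume "\<gamma> \<in> ?G"
    then have \<gamma>: "\<gamma> \<ge> 0" "?\<rho> \<le> \<gamma> powr (1 / real d)"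
      using cjsr_le_of_lyap_feasible[OF assms] by auto
    show "?\<rho> ^ d \<le> \<gamma>"
      using power_mono[OF \<gamma>(2) \<rho>0, of d] powr_inverse_power[OF \<gamma>(1) assms(2)] by simp
  qed
  then have "(?\<rho> ^ d) powr (1 / real d) \<le> ?\<gamma> powr (1 / real d)"
    using \<rho>0 by (intro powr_mono2) auto
  then have lower: "?\<rho> \<le> ?\<gamma> powr (1 / real d)"
    using power_powr_inverse[OF \<rho>0 assms(2)] by simp
  have \<gamma>0: "?\<gamma> \<ge> 0" unfolding gamma_star_def by (rule cInf_greatest[OF Gne]) auto
  have m: "?m > 0" using multi_idx_nonempty by (simp add: card_gt_0_iff)
  \<comment> \<open>Letting \<open>e\<close> tend to 0 from the right removes both at once.\<close>
  have "((\<lambda>e. (?\<rho> + e) ^ d * sqrt (?m + e)) \<longlongrightarrow> (?\<rho> + 0) ^ d * sqrt (?m + 0)) (at_right 0)"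
    by (intro tendsto_intros)
  moreover have "eventually (\<lambda>e. ?\<gamma> \<le> (?\<rho> + e) ^ d * sqrt (?m + e)) (at_right 0)"
    unfolding gamma_star_def
    by (rule eventually_mono[OF eventually_at_right_less[of 0]])
      (intro cInf_lower G bdd_belowI[of _ 0], auto)
  ultimately have "?\<gamma> \<le> (?\<rho> + 0) ^ d * sqrt (?m + 0)"
    by (rule tendsto_lowerbound) simp
  then have "?\<gamma> \<le> sqrt ?m * ?\<rho> ^ d" by (simp add: mult.commute)
  then have "?\<gamma> powr (1 / real d) \<le> sqrt ?m powr (1 / real d) * ?\<rho>"
    using \<gamma>0 \<rho>0 m assms(2) by (intro powr_inverse_nat_le) auto
  also have "sqrt ?m powr (1 / real d) = ?m powr (1 / (2 * real d))"
    using m by (simp add: powr_half_sqrt[symmetric] powr_powr)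
  finally show ?thesis using lower by (simp add: card_multi_idx)
qed

end
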